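(* Let $T$ be a tree on $t\ge 2$ vertices. There exists an integer $n_0=n_0(T)$ such that for every integer $n>n_0$ the following holds. (1) If $t-1$ divides $n$, or if $T$ is a star and at least one of $t$, $n$ is even, then $\mathrm{regex}(n,T)=t-2$. (2) If the condition in (1) does not hold, and at least one of the following holds: $t$ is odd; $t-2$ divides $n$; $T$ is a star; $T$ is an almost-star and $n$ is even; then $\mathrm{regex}(n,T)=t-3$. (3) In all other cases, $\mathrm{regex}(n,T)=t-4$.
   Context: All graphs are finite and simple. A graph is $F$-free if it contains no copy of $F$ as a (not necessarily induced) subgraph. For a graph $F$, $\mathrm{regex}(n,F)$ denotes the maximum integer $d\ge 0$ such that there exists a $d$-regular $F$-free graph on $n$ vertices. A star on $t$ vertices is the tree $K_{1,t-1}$. A tree is called an almost-star if in its proper 2-coloring, one of the color classes consists of at most two vertices. *)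

theory Defs
  imports "Graph_Theory.Graph_Theory"
begin

text \<open>
  A finite simple graph is a \<^locale>\<open>pair_graph\<close>: a finite vertex set together with a finite,
  symmetric and irreflexive set of ordered pairs, so that each undirected edge is represented by
  its two orientations. For such a graph the out-degree of a vertex is its undirected degree.

  The library's notions \<^const>\<open>forest\<close> and \<^const>\<open>tree\<close> are not usable for undirected graphs: there
  the closed walk a, b, a along a single edge already counts as a cycle. Cycles in an undirected
  graph are the cycles of length at least 3.
\<close>

definition undirected_tree :: "'a pair_pre_digraph \<Rightarrow> bool" where
  "undirected_tree G \<longleftrightarrow> pair_graph G \<and> connected (with_proj G) \<and>
     \<not> (\<exists>p. pre_digraph.cycle (with_proj G) p \<and> length p \<ge> 3)"

definition contains_copy :: "'a pair_pre_digraph \<Rightarrow> 'b pair_pre_digraph \<Rightarrow> bool" where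
  "contains_copy F G \<longleftrightarrow>
     (\<exists>H :: 'b pair_pre_digraph. subgraph (with_proj H) (with_proj G) \<and>
        digraph_iso (with_proj F) (with_proj H))"

definition free_of :: "'a pair_pre_digraph \<Rightarrow> 'b pair_pre_digraph \<Rightarrow> bool" where
  "free_of F G \<longleftrightarrow> \<not> contains_copy F G"

definition regular_graph :: "nat \<Rightarrow> 'a pair_pre_digraph \<Rightarrow> bool" where
  "regular_graph d G \<longleftrightarrow> pair_graph G \<and> (\<forall>v \<in> pverts G. out_degree (with_proj G) v = d)"

text \<open>
  Every finite graph is isomorphic to one whose vertices are natural numbers, so it suffices to let
  the host graph range over those. For \<open>n \<ge> 1\<close> the degrees in question are less than \<open>n\<close>, and 0
  is among them as soon as \<open>F\<close> has an edge, hence the maximum is then taken over a finite nonempty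
  set. For \<open>n = 0\<close> the value carries no meaning.
\<close>

definition regex :: "nat \<Rightarrow> 'a pair_pre_digraph \<Rightarrow> nat" where
  "regex n F = Max {d. \<exists>G :: nat pair_pre_digraph.
     regular_graph d G \<and> card (pverts G) = n \<and> free_of F G}"

definition star_graph :: "'a pair_pre_digraph \<Rightarrow> bool" where
  "star_graph G \<longleftrightarrow> complete_bipartite_digraph 1 (card (pverts G) - 1) (with_proj G)"

definition proper_2_coloring :: "'a pair_pre_digraph \<Rightarrow> ('a \<Rightarrow> bool) \<Rightarrow> bool" where
  "proper_2_coloring G c \<longleftrightarrow> (\<forall>(u, v) \<in> parcs G. c u \<noteq> c v)"

text \<open>
  The proper 2-coloring of a tree is unique up to exchanging the two colors, so it does not matter
  which one is chosen.
\<close>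

definition almost_star :: "'a pair_pre_digraph \<Rightarrow> bool" where
  "almost_star G \<longleftrightarrow> undirected_tree G \<and>
     (\<exists>c. proper_2_coloring G c \<and> (\<exists>b. card {v \<in> pverts G. c v = b} \<le> 2))"

end

theory Submission
  imports Defs
begin

text \<open>
  A graph with minimum degree at least \<open>t - 1\<close> contains every tree on \<open>t\<close> vertices greedily. For
  degree \<open>t - 2\<close> only one vertex is missing: if a component is not complete, it has an induced path
  \<open>x, y, z\<close>; mapping the second, third and fourth vertex of a longest path of a non-star to it
  and extending greedily leaves a free neighbor of \<open>x\<close> for the first vertex, a leaf. Hence a \<open>T\<close>-free graph is
  a union of copies of the complete graph on \<open>t - 1\<close> vertices.

  For degree \<open>t - 3\<close> (odd) two leaves \<open>l\<close> and \<open>l'\<close> are removed, and the greedy embedding of the rest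
  is started from a small subtree on which the parent of \<open>l\<close> misses two image vertices and the
  parent of \<open>l'\<close> misses one; then both leaves can be added. Such a start exists when a component
  with at least \<open>t\<close> vertices has a path \<open>x1, x2, x3, x4\<close> in which \<open>x1\<close> is adjacent to neither \<open>x3\<close>
  nor \<open>x4\<close>; it can be lengthened, since a new neighbor of the last vertex is either nonadjacent to
  some path vertex and is appended, or is adjacent to all of them and is inserted. If there is no
  such path, the component is complete multipartite with parts of size at least three, and the start
  can be written down. Only stars and almost-stars have too few branches for either construction.
  By parity, no component has \<open>t - 1\<close> vertices.

  The extremal graphs are disjoint unions of complete graphs, complete graphs minus a perfect
  matching, and balanced complete bipartite graphs.
\<close>

section \<open>Paths, connectivity and embeddings\<close>

text \<open>Connectivity is phrased by cuts, since every use either extracts an edge leaving a set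
  (\<open>adj_connectedD\<close>) or shows that a closed set is everything
  (\<open>adj_connected_closed\<close>).\<close>

definition adj_connected :: "('a \<Rightarrow> 'a \<Rightarrow> bool) \<Rightarrow> 'a set \<Rightarrow> bool" where
  "adj_connected E S \<longleftrightarrow>
     (\<forall>X \<subseteq> S. X \<noteq> {} \<longrightarrow> X \<noteq> S \<longrightarrow> (\<exists>x\<in>X. \<exists>y\<in>S - X. E x y))"

definition simple_path :: "'a set \<Rightarrow> ('a \<Rightarrow> 'a \<Rightarrow> bool) \<Rightarrow> 'a list \<Rightarrow> bool" where
  "simple_path S E xs \<longleftrightarrow> xs \<noteq> [] \<and> set xs \<subseteq> S \<and> distinct xs \<and> successively E xs"

definition nbrs :: "('a \<Rightarrow> 'a \<Rightarrow> bool) \<Rightarrow> 'a \<Rightarrow> 'a set" where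
  "nbrs E v = {w. E v w}"

text \<open>The domain \<open>S\<close> is a parameter, so that an embedding of a subtree can be
  grown vertex by vertex. Copies need not be induced, hence only one implication.\<close>

definition embedding ::
    "('a \<Rightarrow> 'a \<Rightarrow> bool) \<Rightarrow> 'a set \<Rightarrow> ('b \<Rightarrow> 'b \<Rightarrow> bool) \<Rightarrow> 'b set \<Rightarrow> ('a \<Rightarrow> 'b) \<Rightarrow> bool" where
  "embedding E S A C f \<longleftrightarrow>
     inj_on f S \<and> f ` S \<subseteq> C \<and> (\<forall>u\<in>S. \<forall>v\<in>S. E u v \<longrightarrow> A (f u) (f v))"

definition leaf :: "('a \<Rightarrow> 'a \<Rightarrow> bool) \<Rightarrow> 'a \<Rightarrow> 'a \<Rightarrow> bool" where
  "leaf E l p \<longleftrightarrow> nbrs E l = {p}"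

lemma in_nbrs [simp]: "w \<in> nbrs E v \<longleftrightarrow> E v w"
  by (simp add: nbrs_def)

lemma adj_connectedD:
  assumes "adj_connected E S" "X \<subseteq> S" "x \<in> X" "y \<in> S" "y \<notin> X"
  obtains a b where "a \<in> X" "b \<in> S" "b \<notin> X" "E a b"
  using assms unfolding adj_connected_def by blast

lemma adj_connected_closed:
  assumes "adj_connected E S" "X \<subseteq> S" "X \<noteq> {}"
    and "\<And>x y. x \<in> X \<Longrightarrow> y \<in> S \<Longrightarrow> E x y \<Longrightarrow> y \<in> X"
  shows "X = S"
  using assms unfolding adj_connected_def by blast

lemma adj_connected_singleton: "adj_connected E {x}"
  unfolding adj_connected_def by blast

lemma adj_connected_insert:
  assumes "adj_connected E S" "w \<in> S" "E w u" "E u w"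
  shows "adj_connected E (insert u S)"
  unfolding adj_connected_def
proof (intro allI impI)
  fix X assume X: "X \<subseteq> insert u S" "X \<noteq> {}" "X \<noteq> insert u S"
  show "\<exists>x\<in>X. \<exists>y\<in>insert u S - X. E x y"
  proof (cases "X \<inter> S = {} \<or> S \<subseteq> X")
    case True
    then show ?thesis using X assms(2-4) by blast
  next
    case False
    then have "X \<inter> S \<subseteq> S" "X \<inter> S \<noteq> {}" "X \<inter> S \<noteq> S" by blast+
    then obtain x y where "x \<in> X \<inter> S" "y \<in> S - X \<inter> S" "E x y"
      using assms(1) unfolding adj_connected_def by meson
    then show ?thesis by blast
  qed
qed

text \<open>The end points of simple paths from \<open>a\<close> form a closed set: an edge to a new
  vertex lengthens the path, and an edge to a vertex already on it is answered by cutting the path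
  at that vertex.\<close>

lemma adj_connected_path:
  assumes "adj_connected E S" "a \<in> S" "b \<in> S"
  shows "\<exists>xs. simple_path S E xs \<and> hd xs = a \<and> last xs = b"
proof -
  define X where "X = {b \<in> S. \<exists>xs. simple_path S E xs \<and> hd xs = a \<and> last xs = b}"
  have "simple_path S E [a]" using assms(2) by (simp add: simple_path_def)
  then have a: "a \<in> X" using assms(2) unfolding X_def by force
  have "X = S"
  proof (rule adj_connected_closed[OF assms(1)])
    show "X \<subseteq> S" "X \<noteq> {}" using a by (auto simp: X_def)
    fix x y assume x: "x \<in> X" and y: "y \<in> S" and e: "E x y"
    obtain xs where xs: "simple_path S E xs" "hd xs = a" "last xs = x"
      using x by (auto simp: X_def)
    show "y \<in> X"
    proof (cases "y \<in> set xs")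
      case False
      then have "simple_path S E (xs @ [y])"
        using xs y e by (auto simp: simple_path_def successively_append_iff)
      moreover have "hd (xs @ [y]) = a" "last (xs @ [y]) = y"
        using xs by (auto simp: simple_path_def)
      ultimately show ?thesis using y unfolding X_def by blast
    next
      case True
      then obtain ps qs where ps: "xs = ps @ y # qs" by (auto simp: in_set_conv_decomp)
      have "simple_path S E (ps @ [y])"
        using xs(1) unfolding ps by (auto simp: simple_path_def successively_append_iff)
      moreover have "hd (ps @ [y]) = a" using xs(2) unfolding ps by (cases ps) auto
      ultimately show ?thesis using y unfolding X_def by force
    qed
  qed
  then show ?thesis using assms(3) unfolding X_def by blast
qed

lemma simple_path_Cons:
  "simple_path S E (x # y # xs) \<longleftrightarrow>
     x \<in> S \<and> x \<notin> set (y # xs) \<and> E x y \<and> simple_path S E (y # xs)"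
  by (auto simp: simple_path_def)

lemma embedding_adj_mono:
  assumes "embedding E S A C f" "\<And>x y. A x y \<Longrightarrow> B x y" "C \<subseteq> D"
  shows "embedding E S B D f"
  using assms unfolding embedding_def by blast

lemma embedding_insert:
  assumes "embedding E S A C f" "u \<notin> S" "\<And>w. w \<in> S \<Longrightarrow> E u w \<Longrightarrow> A y (f w)"
    "\<And>w. w \<in> S \<Longrightarrow> E w u \<Longrightarrow> A (f w) y" "\<not> E u u" "y \<in> C" "y \<notin> f ` S"
  shows "embedding E (insert u S) A C (f(u := y))"
proof -
  have "inj_on (f(u := y)) (insert u S)"
    using assms(1,2,7) unfolding embedding_def inj_on_def by auto
  moreover have "(f(u := y)) ` insert u S \<subseteq> C"
    using assms(1,2,6) unfolding embedding_def by auto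
  ultimately show ?thesis
    using assms unfolding embedding_def by auto
qed

lemma embedding_card:
  assumes "embedding E S A C f" "finite C"
  shows "card S \<le> card C"
  using assms card_inj_on_le unfolding embedding_def by blast

section \<open>Finite simple graphs as adjacency predicates\<close>

locale adj_graph =
  fixes V :: "'a set" and E :: "'a \<Rightarrow> 'a \<Rightarrow> bool"
  assumes finite_V: "finite V"
    and adj_in1: "E u v \<Longrightarrow> u \<in> V"
    and adj_sym: "E u v \<Longrightarrow> E v u"
    and adj_irrefl: "\<not> E u u"
begin

lemma adj_in2: "E u v \<Longrightarrow> v \<in> V"
  using adj_in1 adj_sym by blast

lemma adj_neq: "E u v \<Longrightarrow> u \<noteq> v"
  using adj_irrefl by blast

lemma nbrs_subset: "nbrs E v \<subseteq> V"
  using adj_in2 by auto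

lemma finite_nbrs: "finite (nbrs E v)"
  using nbrs_subset finite_V finite_subset by blast

lemma simple_path_rev: "simple_path S E (rev xs) \<longleftrightarrow> simple_path S E xs"
proof -
  have "(\<lambda>x y. E y x) = E" using adj_sym by (intro ext) blast
  then show ?thesis unfolding simple_path_def successively_rev by (simp only: set_rev distinct_rev rev_is_Nil_conv)
qed

lemma adj_connected_simple_path:
  "simple_path S E xs \<Longrightarrow> adj_connected E (set xs)"
proof (induction xs)
  case (Cons x xs)
  show ?case
  proof (cases xs)
    case Nil
    then show ?thesis by (simp add: adj_connected_singleton)
  next
    case (Cons y ys)
    then have "adj_connected E (set xs)" "E x y" "y \<in> set xs"
      using Cons.prems Cons.IH by (auto simp: simple_path_def)
    then show ?thesis using adj_connected_insert[of E "set xs" y x] adj_sym by simp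
  qed
qed (simp add: simple_path_def)

text \<open>If \<open>X\<close> contains the parent \<open>p\<close>, then \<open>l\<close> is first
  added to \<open>X\<close>, and no leaving edge starts at \<open>l\<close>; otherwise no edge from
  \<open>X\<close> ends in \<open>l\<close> within \<open>S\<close>.\<close>

lemma adj_connected_remove_leaf:
  assumes "adj_connected E S" "leaf E l p"
  shows "adj_connected E (S - {l})"
  unfolding adj_connected_def
proof (intro allI impI)
  fix X assume X: "X \<subseteq> S - {l}" "X \<noteq> {}" "X \<noteq> S - {l}"
  have l: "E l w \<longleftrightarrow> w = p" for w
    using assms(2) unfolding leaf_def by (metis in_nbrs singletonD singletonI)
  obtain x where x: "x \<in> X" using X by blast
  obtain y where y: "y \<in> S" "y \<noteq> l" "y \<notin> X" using X by blast
  show "\<exists>x\<in>X. \<exists>y\<in>S - {l} - X. E x y"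
  proof (cases "p \<in> X \<and> l \<in> S")
    case True
    then have sub: "insert l X \<subseteq> S" "x \<in> insert l X" "y \<notin> insert l X" using X x y by auto
    obtain a b where ab: "a \<in> insert l X" "b \<in> S" "b \<notin> insert l X" "E a b"
      using adj_connectedD[OF assms(1) sub(1,2) y(1) sub(3)] .
    then have "a \<noteq> l" using l[of b] True by auto
    then show ?thesis using ab by auto
  next
    case False
    have sub: "X \<subseteq> S" using X by auto
    obtain a b where ab: "a \<in> X" "b \<in> S" "b \<notin> X" "E a b"
      using adj_connectedD[OF assms(1) sub x y(1) y(3)] .
    have "b \<noteq> l" using ab l[of a] adj_sym[of a b] False by metis
    then show ?thesis using ab by auto
  qed
qed

end

text \<open>Cycles are represented by paths whose end points are adjacent.\<close>

locale adj_tree = adj_graph +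
  assumes conn: "adj_connected E V"
    and acyclic: "simple_path V E xs \<Longrightarrow> length xs \<ge> 3 \<Longrightarrow> \<not> E (last xs) (hd xs)"
begin

text \<open>Two different neighbors of \<open>u\<close> in \<open>S\<close> would be joined by a
  path inside \<open>S\<close>, which \<open>u\<close> closes to a cycle.\<close>

lemma unique_nbr:
  assumes "adj_connected E S" "S \<subseteq> V" "u \<notin> S" "a \<in> S" "b \<in> S" "E u a" "E u b"
  shows "a = b"
proof (rule ccontr)
  assume "a \<noteq> b"
  obtain xs where xs: "simple_path S E xs" "hd xs = a" "last xs = b"
    using adj_connected_path assms by metis
  then obtain y ys where ys: "xs = a # y # ys"
    using \<open>a \<noteq> b\<close> by (cases xs; cases "tl xs") (auto simp: simple_path_def)
  have "simple_path V E (u # xs)"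
    using xs assms adj_in1[OF assms(6)] unfolding ys by (auto simp: simple_path_def)
  then have "\<not> E (last (u # xs)) (hd (u # xs))" by (rule acyclic) (simp add: ys)
  then show False using xs assms adj_sym ys by auto
qed

text \<open>If \<open>u\<close> were already on the tail, then \<open>w\<close> would have the two
  neighbors \<open>u\<close> and \<open>x\<close> in a connected set avoiding \<open>w\<close>,
  contrary to \<open>unique_nbr\<close>.\<close>

lemma simple_path_extend:
  assumes "simple_path V E (w # x # xs)" "E u w" "u \<noteq> x"
  shows "simple_path V E (u # w # x # xs)"
proof -
  have p: "simple_path V E (x # xs)" and w: "w \<notin> set (x # xs)" "E w x"
    using assms(1) by (auto simp: simple_path_def)
  have "u \<notin> set (x # xs)"
    using unique_nbr[OF adj_connected_simple_path[OF p] _ w(1), of u x] p w assms(2,3) adj_sym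
    by (auto simp: simple_path_def)
  then show ?thesis
    using assms adj_neq[OF assms(2)] adj_in1[OF assms(2)] by (auto simp: simple_path_def)
qed

text \<open>By \<open>unique_nbr\<close> the edge to \<open>w\<close> is the only one between
  \<open>u\<close> and \<open>S\<close>, so a single adjacency has to be respected in the
  host.\<close>

lemma embedding_extend:
  assumes "embedding E S A C f" "adj_connected E S" "S \<subseteq> V" "w \<in> S" "u \<notin> S" "E w u"
    "A (f w) y" "A y (f w)" "y \<in> C" "y \<notin> f ` S"
  shows "embedding E (insert u S) A C (f(u := y))"
proof (rule embedding_insert[OF assms(1,5)])
  have "v = w" if "v \<in> S" "E u v" for v
    using unique_nbr[OF assms(2,3,5) that(1) assms(4) that(2)] adj_sym[OF assms(6)] by simp
  then show "\<And>v. v \<in> S \<Longrightarrow> E u v \<Longrightarrow> A y (f v)" "\<And>v. v \<in> S \<Longrightarrow> E v u \<Longrightarrow> A (f v) y"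
    using assms adj_sym by blast+
qed (use assms adj_irrefl in auto)

lemma embedding_path:
  assumes "adj_graph C A"
  shows "simple_path V E vs \<Longrightarrow> simple_path C A xs \<Longrightarrow> length vs = length xs \<Longrightarrow>
    \<exists>f. embedding E (set vs) A C f \<and> map f vs = xs"
proof (induction vs arbitrary: xs)
  case (Cons v vs)
  obtain x xs' where xs: "xs = x # xs'" using Cons.prems(3) by (cases xs) auto
  show ?case
  proof (cases vs)
    case Nil
    then have "embedding E (set (v # vs)) A C (\<lambda>_. x) \<and> map (\<lambda>_. x) (v # vs) = xs"
      using Cons.prems xs adj_irrefl by (auto simp: embedding_def simple_path_def)
    then show ?thesis by blast
  next
    case (Cons w ws)
    then obtain y ys where xs': "xs' = y # ys" using Cons.prems(3) xs by (cases xs') auto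
    have p: "simple_path V E vs" "simple_path C A xs'" "v \<notin> set vs" "x \<notin> set xs'"
      "E v w" "A x y" "x \<in> C" "v \<in> V" "length vs = length xs'"
      using Cons.prems unfolding xs xs' Cons by (auto simp: simple_path_Cons)
    obtain f where f: "embedding E (set vs) A C f" "map f vs = xs'"
      using Cons.IH p by blast
    have "f w = y" using f(2) unfolding Cons xs' by simp
    then have "embedding E (insert v (set vs)) A C (f(v := x))"
      using p f adj_graph.adj_sym[OF assms] adj_sym
      by (intro embedding_extend[OF f(1) adj_connected_simple_path[OF p(1)], of w])
         (auto simp: Cons simple_path_def simp flip: f(2))
    moreover have "map (f(v := x)) (v # vs) = xs"
      using f(2) p(3) xs by (auto simp: map_fun_upd)
    ultimately show ?thesis by auto
  qed
qed (simp add: simple_path_def)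

text \<open>As long as \<open>S\<close> is not all of \<open>S'\<close>, some edge leaves
  \<open>S\<close> at a vertex \<open>w\<close>. Apart from \<open>f w\<close> itself, at most
  \<open>card S' - 2\<close> vertices are occupied, so one of the at least
  \<open>card S' - 1\<close> neighbors of \<open>f w\<close> is free.\<close>

lemma embedding_greedy:
  assumes "adj_graph C A" "adj_connected E S'" "S' \<subseteq> V"
    and deg: "\<And>x. x \<in> C \<Longrightarrow> card S' \<le> card (nbrs A x) + 1"
  shows "embedding E S A C f \<Longrightarrow> adj_connected E S \<Longrightarrow> S \<noteq> {} \<Longrightarrow> S \<subseteq> S' \<Longrightarrow>
    \<exists>g. embedding E S' A C g \<and> (\<forall>v\<in>S. g v = f v)"
proof (induction "card (S' - S)" arbitrary: S f)
  case 0
  have "finite S'" using assms(3) finite_V finite_subset by blast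
  then have "S = S'" using 0 by auto
  then show ?case using 0 by blast
next
  case (Suc n)
  interpret H: adj_graph C A by fact
  have fin: "finite S'" "finite S"
    using assms(3) Suc.prems(4) finite_V finite_subset by metis+
  have "S \<noteq> S'" using Suc.hyps(2) by auto
  then obtain v where v: "v \<in> S'" "v \<notin> S" using Suc.prems by blast
  obtain v' where v': "v' \<in> S" using Suc.prems by blast
  obtain w u where wu: "w \<in> S" "u \<in> S'" "u \<notin> S" "E w u"
    using adj_connectedD[OF assms(2) Suc.prems(4) v' v] .
  have w: "f w \<in> C" using Suc.prems(1) wu unfolding embedding_def by auto
  have "card (f ` S) \<le> card S" using fin card_image_le by blast
  moreover have "card S < card S'"
    using fin Suc.prems(4) \<open>S \<noteq> S'\<close> by (simp add: psubset_card_mono psubsetI)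
  moreover have "card (f ` S - {f w}) < card (f ` S)"
    using fin wu by (intro psubset_card_mono) auto
  ultimately have "card (f ` S - {f w}) < card (nbrs A (f w))" using deg[OF w] by linarith
  then have "\<not> nbrs A (f w) \<subseteq> f ` S - {f w}" using fin by (meson card_mono finite_Diff finite_imageI leD)
  then obtain y where "y \<in> nbrs A (f w)" "y \<notin> f ` S - {f w}" by blast
  then have y: "A (f w) y" "y \<notin> f ` S" using H.adj_neq by auto
  have "embedding E (insert u S) A C (f(u := y))"
    using y wu Suc.prems assms(3) H.adj_sym H.adj_in2
    by (intro embedding_extend[OF Suc.prems(1,2), of w]) auto
  moreover have "n = card (S' - insert u S)"
    using Suc.hyps(2) wu fin by (simp add: card_Diff_insert)
  moreover have "adj_connected E (insert u S)"
    using adj_connected_insert[OF Suc.prems(2) wu(1,4)] adj_sym wu by blast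
  ultimately obtain g where g: "embedding E S' A C g" "\<forall>v\<in>insert u S. g v = (f(u := y)) v"
    using Suc.hyps(1)[of "insert u S" "f(u := y)"] wu Suc.prems by auto
  then have "\<forall>v\<in>S. g v = f v" using wu(3) by auto
  then show ?case using g(1) by blast
qed

lemma longest_path:
  assumes "V \<noteq> {}"
  shows "\<exists>xs. simple_path V E xs \<and> (\<forall>ys. simple_path V E ys \<longrightarrow> length ys \<le> length xs)"
proof -
  obtain v where "v \<in> V" using assms by blast
  then have "simple_path V E [v]" by (simp add: simple_path_def)
  moreover have "\<forall>ys. simple_path V E ys \<longrightarrow> length ys < Suc (card V)"
  proof (intro allI impI)
    fix ys assume "simple_path V E ys"
    then have "set ys \<subseteq> V" "card (set ys) = length ys"
      by (auto simp: simple_path_def distinct_card)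
    then show "length ys < Suc (card V)" using card_mono[OF finite_V] by (metis le_imp_less_Suc)
  qed
  ultimately show ?thesis by (rule ex_has_greatest_nat)
qed

end

section \<open>Longest paths in trees\<close>

context adj_tree
begin

lemma leafD:
  assumes "leaf E l p"
  shows "E l p" "E p l" "l \<in> V" "p \<in> V" "l \<noteq> p" "E l w \<Longrightarrow> w = p"
proof -
  show "E l p" "E l w \<Longrightarrow> w = p" using assms unfolding leaf_def nbrs_def by auto
  then show "E p l" "l \<in> V" "p \<in> V" "l \<noteq> p" using adj_sym adj_in1 adj_neq by blast+
qed

text \<open>A second neighbor of the end vertex would lengthen the path, by
  \<open>simple_path_extend\<close>.\<close>

lemma leaf_end_of_longest_path:
  assumes "simple_path V E (x # y # xs)"
    and "\<And>ys. simple_path V E ys \<Longrightarrow> length ys \<le> length (x # y # xs)"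
  shows "leaf E x y"
proof -
  have "w = y" if "E x w" for w
  proof (rule ccontr)
    assume "w \<noteq> y"
    then have "simple_path V E (w # x # y # xs)"
      using simple_path_extend[OF assms(1)] adj_sym that by blast
    from assms(2)[OF this] show False by simp
  qed
  moreover have "E x y" using assms(1) by (simp add: simple_path_def)
  ultimately have "E x w \<longleftrightarrow> w = y" for w by metis
  then show ?thesis unfolding leaf_def by (simp add: set_eq_iff)
qed

lemma star_or_path4:
  assumes "card V \<ge> 2"
  shows "(\<exists>c\<in>V. \<forall>u v. E u v \<longleftrightarrow> u \<in> V \<and> v \<in> V \<and> u \<noteq> v \<and> (u = c \<or> v = c)) \<or>
    (\<exists>a b c d. simple_path V E [a, b, c, d])"
proof (rule disjCI)
  assume no: "\<not> (\<exists>a b c d. simple_path V E [a, b, c, d])"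
  have long: "\<not> simple_path V E (a # b # c # d # xs)" for a b c d xs
  proof
    assume "simple_path V E (a # b # c # d # xs)"
    then have "simple_path V E [a, b, c, d]" by (simp add: simple_path_def)
    then show False using no by blast
  qed
  obtain v where v: "v \<in> V" using assms by fastforce
  have "V \<noteq> {v}" using assms by auto
  then obtain w where vw: "E v w"
    using conn v unfolding adj_connected_def by (metis empty_subsetI insert_not_empty insert_subset singletonD)
  \<comment> \<open>\<open>c\<close> will be the center: a neighbor of \<open>c\<close> has no
    neighbor other than \<open>c\<close>. The middle vertex of a path on three vertices serves;
    without such a path an end of any edge does.\<close>
  have "\<exists>c a. E a c \<and> (\<forall>w. E w c \<longrightarrow> (\<forall>u. E u w \<longrightarrow> u = c))"
  proof (cases "\<exists>a b c. simple_path V E [a, b, c]")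
    case True
    then obtain a b c where abc: "simple_path V E [a, b, c]" by blast
    have "u = b" if "E w b" "E u w" for u w
    proof (rule ccontr)
      assume "u \<noteq> b"
      have "simple_path V E [c, b, a]" using simple_path_rev[of V "[a, b, c]"] abc by simp
      moreover have "E a b" using abc by (simp add: simple_path_def)
      ultimately have "\<exists>d. simple_path V E [w, b, d]"
      proof (cases "w = a")
        case False
        have "simple_path V E [b, a]"
          using \<open>simple_path V E [c, b, a]\<close> by (simp add: simple_path_def)
        then show ?thesis using simple_path_extend[of b a "[]" w] that False by blast
      qed (use abc in blast)
      then obtain d where "simple_path V E [w, b, d]" by blast
      then have "simple_path V E (u # w # b # d # [])"
        using simple_path_extend[of w b "[d]" u] that \<open>u \<noteq> b\<close> by blast
      then show False using long by blast
    qed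
    moreover have "E a b" using abc by (simp add: simple_path_def)
    ultimately show ?thesis by blast
  next
    case False
    have "u = w" if "E x w" "E u x" for u x
    proof (rule ccontr)
      assume "u \<noteq> w"
      have "simple_path V E [x, w]"
        using that adj_neq adj_in1 adj_in2 by (simp add: simple_path_def)
      then have "simple_path V E [u, x, w]"
        using simple_path_extend[of x w "[]" u] that \<open>u \<noteq> w\<close> by blast
      then show False using False by blast
    qed
    then show ?thesis using vw by blast
  qed
  then obtain c a where c: "E a c" "\<And>w u. E w c \<Longrightarrow> E u w \<Longrightarrow> u = c" by blast
  have "insert c (nbrs E c) = V"
    using c adj_sym adj_in2[OF c(1)] nbrs_subset
    by (intro adj_connected_closed[OF conn]) auto
  then have V: "x \<in> V \<longleftrightarrow> x = c \<or> E c x" for x by auto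
  have "E u v \<longleftrightarrow> u \<in> V \<and> v \<in> V \<and> u \<noteq> v \<and> (u = c \<or> v = c)" for u v
  proof
    assume e: "E u v"
    have "u = c \<or> v = c" using V[of u] adj_in1[OF e] c(2)[of u v] adj_sym[OF e] adj_sym[of c u] by blast
    then show "u \<in> V \<and> v \<in> V \<and> u \<noteq> v \<and> (u = c \<or> v = c)"
      using e adj_in1 adj_in2 adj_neq by blast
  next
    assume "u \<in> V \<and> v \<in> V \<and> u \<noteq> v \<and> (u = c \<or> v = c)"
    then show "E u v" using V[of u] V[of v] adj_sym[of c u] by auto
  qed
  then show "\<exists>c\<in>V. \<forall>u v. E u v \<longleftrightarrow> u \<in> V \<and> v \<in> V \<and> u \<noteq> v \<and> (u = c \<or> v = c)"
    using adj_in2[OF c(1)] by blast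
qed

text \<open>Replacing \<open>a\<close> by \<open>w\<close> gives another path on four vertices,
  which is again a longest one, so its end is a leaf.\<close>

lemma path4_nbr_leaf:
  assumes "simple_path V E [a, b, c, d]" "\<And>ys. simple_path V E ys \<Longrightarrow> length ys \<le> 4"
    and "E w b" "w \<noteq> c"
  shows "leaf E w b"
proof (rule leaf_end_of_longest_path)
  have "simple_path V E [b, c, d]" using assms(1) by (simp add: simple_path_def)
  then show "simple_path V E [w, b, c, d]" using simple_path_extend assms(3,4) by blast
  show "\<And>ys. simple_path V E ys \<Longrightarrow> length ys \<le> length [w, b, c, d]" using assms(2) by (simp add: eval_nat_numeral)
qed

text \<open>The tree is a double star with centers \<open>b\<close> and \<open>c\<close> in which
  \<open>b\<close> carries only the leaf \<open>a\<close>. One color class is then \<open>a\<close>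
  together with \<open>c\<close>, which makes the tree an almost-star.\<close>

lemma double_star_coloring:
  assumes "simple_path V E [a, b, c, d]" "\<And>ys. simple_path V E ys \<Longrightarrow> length ys \<le> 4"
    and b: "\<And>w. E w b \<Longrightarrow> w = a \<or> w = c"
    and "E u v"
  shows "(u \<in> {a, c}) \<noteq> (v \<in> {a, c})"
proof -
  have p: "simple_path V E [d, c, b, a]" using simple_path_rev[of V "[a, b, c, d]"] assms(1) by simp
  have e: "E a b" "E b c" "distinct [a, b, c, d]" using assms(1) by (auto simp: simple_path_def)
  have la: "leaf E w c" if "E w c" "w \<noteq> b" for w
    using path4_nbr_leaf[OF p assms(2) that] by simp
  have lb: "leaf E a b" using path4_nbr_leaf[OF assms(1,2) e(1)] e(3) by auto
  have "nbrs E b \<union> nbrs E c = V"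
  proof (rule adj_connected_closed[OF conn])
    show "nbrs E b \<union> nbrs E c \<subseteq> V" using nbrs_subset by blast
    show "nbrs E b \<union> nbrs E c \<noteq> {}" using e by auto
    fix x y assume xy: "x \<in> nbrs E b \<union> nbrs E c" "E x y"
    then consider "x = a" | "x = c" | "x = b" | "E x c" "x \<noteq> b"
      using b[of x] adj_sym[of b x] adj_sym[of c x] by auto
    then show "y \<in> nbrs E b \<union> nbrs E c"
      using leafD(6)[OF lb, of y] leafD(6)[OF la, of x y] xy e adj_sym[of b c] adj_sym[of x b] adj_sym[of x c]
      by cases auto
  qed
  then have "u \<in> nbrs E b \<union> nbrs E c" using adj_in1[OF assms(4)] by simp
  then have "u = a \<or> u = c \<or> u = b \<or> (E u c \<and> u \<noteq> b)"
    using b[of u] adj_sym[of b u] adj_sym[of c u] by auto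
  moreover have "\<not> E a c" using leafD(6)[OF lb, of c] e by auto
  then have "\<not> E a c" "\<not> E c a" using adj_sym by blast+
  ultimately show ?thesis
    using leafD(6)[OF lb, of v] leafD(6)[OF la, of u v] assms(4) e b[of v] adj_sym[OF assms(4)] adj_irrefl
    by auto
qed

text \<open>As no path has six vertices and \<open>c\<close> has only the neighbors \<open>b\<close>
  and \<open>d\<close>, all other vertices are leaves at \<open>b\<close> or \<open>d\<close>; so
  \<open>b\<close> and \<open>d\<close> form a color class.\<close>

lemma spider_coloring:
  assumes "simple_path V E [a, b, c, d, e]" "\<And>ys. simple_path V E ys \<Longrightarrow> length ys \<le> 5"
    and c: "\<And>w. E w c \<Longrightarrow> w = b \<or> w = d"
    and "E u v"
  shows "(u \<in> {b, d}) \<noteq> (v \<in> {b, d})"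
proof -
  \<comment> \<open>A neighbor of \<open>b\<close> other than \<open>c\<close> is a leaf, since
    otherwise \<open>x, w, b, c, d, e\<close> is too long. The path is quantified so that the
    reversed path yields the same fact for \<open>d\<close>.\<close>
  have far: "x = b" if "simple_path V E [a, b, c, d, e]" "E w b" "w \<noteq> c" "E w x" for a b c d e w x
  proof (rule ccontr)
    assume "x \<noteq> b"
    have "simple_path V E [b, c, d, e]" using that(1) by (simp add: simple_path_def)
    then have "simple_path V E [w, b, c, d, e]" using simple_path_extend that by blast
    then have "simple_path V E [x, w, b, c, d, e]"
      using simple_path_extend[of w b "[c, d, e]" x] adj_sym that \<open>x \<noteq> b\<close> by blast
    from assms(2)[OF this] show False by simp
  qed
  have p: "simple_path V E [e, d, c, b, a]"
    using simple_path_rev[of V "[a, b, c, d, e]"] assms(1) by simp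
  have ed: "E a b" "E b c" "E c d" "E d e" "distinct [a, b, c, d, e]"
    using assms(1) by (auto simp: simple_path_def)
  have bd: "\<not> E b d"
  proof
    assume "E b d"
    have "simple_path V E [b, c, d]" using assms(1) by (simp add: simple_path_def)
    from acyclic[OF this] show False using adj_sym[OF \<open>E b d\<close>] by simp
  qed
  note fb = far[OF assms(1)] and fd = far[OF p]
  have "insert c (nbrs E b \<union> nbrs E d) \<union> {b, d} = V"
  proof (rule adj_connected_closed[OF conn])
    show "insert c (nbrs E b \<union> nbrs E d) \<union> {b, d} \<subseteq> V"
      using nbrs_subset ed adj_in1 adj_in2 by auto
    fix x y assume "x \<in> insert c (nbrs E b \<union> nbrs E d) \<union> {b, d}" "E x y"
    then consider "x = c" | "x = b" | "x = d" | "E x b" "x \<noteq> c" | "E x d" "x \<noteq> c"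
      using adj_sym[of b x] adj_sym[of d x] by auto
    then show "y \<in> insert c (nbrs E b \<union> nbrs E d) \<union> {b, d}"
      using fb[of x y] fd[of x y] c[of y] adj_sym[OF \<open>E x y\<close>] \<open>E x y\<close> by cases auto
  qed simp
  then have "u \<in> insert c (nbrs E b \<union> nbrs E d) \<union> {b, d}" using adj_in1[OF assms(4)] by simp
  then consider "u = c" | "u = b" | "u = d" | "E u b" "u \<noteq> c" | "E u d" "u \<noteq> c"
    using adj_sym[of b u] adj_sym[of d u] by auto
  then show ?thesis
  proof cases
    case 1 then show ?thesis using c[of v] adj_sym[OF assms(4)] ed by auto
  next
    case 2 then show ?thesis using bd adj_irrefl[of b] assms(4) by auto
  next
    case 3 then show ?thesis using bd adj_sym[of d b] adj_irrefl[of d] assms(4) by auto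
  next
    case 4
    then have "v = b" using fb assms(4) by blast
    then show ?thesis using assms(4) adj_neq[OF assms(4)] bd adj_sym[of d b] by auto
  next
    case 5
    then have "v = d" using fd assms(4) by blast
    then show ?thesis using assms(4) adj_neq[OF assms(4)] bd adj_sym[of d b] by auto
  qed
qed

text \<open>The cases follow the order of a longest path: four, five, or at least six vertices. For
  four and five, the extra branches exist because otherwise one of the two coloring lemmas gives a
  color class of size two, excluded by \<open>no_coloring\<close>.\<close>

lemma tree_structure:
  assumes "simple_path V E [a, b, c, d]"
    and no_coloring: "\<And>P. P \<subseteq> V \<Longrightarrow> card P \<le> 2 \<Longrightarrow> \<exists>u v. E u v \<and> (u \<in> P \<longleftrightarrow> v \<in> P)"
  obtains
    (double_star) l l' p q r r' where
      "leaf E l p" "leaf E l' p" "l \<noteq> l'" "simple_path V E [p, q, r]" "E q r'" "r' \<noteq> p" "r' \<noteq> r"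
      "q \<noteq> l" "q \<noteq> l'"
  | (spider) l p g p' l' u where
      "leaf E l p" "leaf E l' p'" "simple_path V E [l, p, g, p', l']" "E g u" "u \<noteq> p" "u \<noteq> p'"
  | (long) l vs l' where
      "leaf E l (hd vs)" "leaf E l' (last vs)" "simple_path V E (l # vs @ [l'])" "length vs \<ge> 4"
proof -
  \<comment> \<open>Closes the branches in which the tree turns out to be an almost-star.\<close>
  have bad: thesis if "x \<in> V" "y \<in> V" "\<And>u v. E u v \<Longrightarrow> (u \<in> {x, y}) \<noteq> (v \<in> {x, y})" for x y
  proof -
    have "card {x, y} \<le> 2" by (simp add: card_insert_if)
    then obtain u v where "E u v" "u \<in> {x, y} \<longleftrightarrow> v \<in> {x, y}"
      using no_coloring[of "{x, y}"] \<open>x \<in> V\<close> \<open>y \<in> V\<close> by blast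
    then show thesis using that(3)[of u v] by blast
  qed
  have "V \<noteq> {}" using assms(1) by (auto simp: simple_path_def)
  then obtain xs where xs: "simple_path V E xs" "\<And>ys. simple_path V E ys \<Longrightarrow> length ys \<le> length xs"
    using longest_path by blast
  have "length xs \<ge> 4" using xs(2)[OF assms(1)] by simp
  then obtain q0 q1 q2 q3 rest where q: "xs = q0 # q1 # q2 # q3 # rest"
    by (auto simp: numeral_eq_Suc Suc_le_length_iff)
  have l0: "leaf E q0 q1" using leaf_end_of_longest_path xs unfolding q by blast
  have rxs: "simple_path V E (rev xs)" "\<And>ys. simple_path V E ys \<Longrightarrow> length ys \<le> length (rev xs)"
    using xs simple_path_rev by auto
  consider "rest = []" | q4 where "rest = [q4]" | q4 q5 rest' where "rest = q4 # q5 # rest'"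
    by (cases rest; cases "tl rest") auto
  then show thesis
  proof cases
    case 1
    have p: "simple_path V E [q0, q1, q2, q3]" "\<And>ys. simple_path V E ys \<Longrightarrow> length ys \<le> 4"
      using xs unfolding q 1 by (simp_all add: eval_nat_numeral)
    have pr: "simple_path V E [q3, q2, q1, q0]" using rxs(1) unfolding q 1 by simp
    have e: "E q0 q1" "E q1 q2" "E q2 q3" "distinct [q0, q1, q2, q3]" "{q0,q1,q2,q3} \<subseteq> V"
      using p(1) by (auto simp: simple_path_def)
    show thesis
    proof (cases "(\<exists>l. E l q1 \<and> l \<noteq> q0 \<and> l \<noteq> q2) \<and> (\<exists>r. E r q2 \<and> r \<noteq> q3 \<and> r \<noteq> q1)")
      case True
      then obtain l r where l: "E l q1" "l \<noteq> q0" "l \<noteq> q2" and r: "E r q2" "r \<noteq> q3" "r \<noteq> q1" by blast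
      have "simple_path V E [q1, q2, q3]" using p(1) by (simp add: simple_path_def)
      then show thesis
        using double_star[of q0 q1 l q2 q3 r] l0 path4_nbr_leaf[OF p l(1,3)] l r e adj_sym by auto
    next
      case False
      then consider "\<And>w. E w q1 \<Longrightarrow> w = q0 \<or> w = q2" | "\<And>w. E w q2 \<Longrightarrow> w = q3 \<or> w = q1" by blast
      then show thesis
      proof cases
        case 1
        then show thesis
          by (intro bad[of q0 q2] double_star_coloring[OF p]) (use e in auto)
      next
        case 2
        then show thesis
          by (intro bad[of q3 q1] double_star_coloring[OF pr p(2)]) (use e in auto)
      qed
    qed
  next
    case 2
    have p: "simple_path V E [q0, q1, q2, q3, q4]" "\<And>ys. simple_path V E ys \<Longrightarrow> length ys \<le> 5"
      using xs unfolding q 2 by (simp_all add: eval_nat_numeral)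
    have l4: "leaf E q4 q3" using leaf_end_of_longest_path[of q4 q3 "[q2, q1, q0]"] rxs unfolding q 2 by simp
    show thesis
    proof (cases "\<exists>u. E u q2 \<and> u \<noteq> q1 \<and> u \<noteq> q3")
      case True
      then show thesis using spider[OF l0 l4 p(1)] adj_sym by blast
    next
      case False
      then show thesis
        by (intro bad[of q1 q3] spider_coloring[OF p]) (use p(1) in \<open>auto simp: simple_path_def\<close>)
    qed
  next
    case 3
    define vs where "vs = q1 # q2 # q3 # butlast (q4 # q5 # rest')"
    define l' where "l' = last xs"
    have xs_eq: "xs = q0 # vs @ [l']" unfolding vs_def l'_def q 3 by simp
    have "rev xs = l' # last vs # rev (q0 # butlast vs)"
      unfolding xs_eq by (simp add: vs_def flip: append_butlast_last_id[of vs])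
    then have "leaf E l' (last vs)" using leaf_end_of_longest_path rxs by metis
    then show thesis using long[of q0 vs l'] l0 xs(1) unfolding xs_eq by (simp add: vs_def)
  qed
qed

end

section \<open>Connected regular graphs\<close>

text \<open>Models one component of a regular host graph; a tree, being connected, embeds into the
  host only through a component.\<close>

locale regular_host = adj_graph C A for C :: "'b set" and A +
  fixes d :: nat
  assumes host_conn: "adj_connected A C"
    and deg: "x \<in> C \<Longrightarrow> card (nbrs A x) = d"
begin

text \<open>The closed neighborhood of \<open>x\<close> has \<open>d + 1\<close> vertices and so is
  not all of \<open>C\<close>; an edge leaving it starts at a neighbor \<open>y\<close> of
  \<open>x\<close>.\<close>

lemma obtain_induced_path3:
  assumes "d + 2 \<le> card C"
  obtains x y z where "A x y" "A y z" "x \<noteq> z" "\<not> A x z"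
proof -
  obtain x where x: "x \<in> C" using assms by fastforce
  have "card (insert x (nbrs A x)) < card C"
    using assms deg[OF x] finite_nbrs[of x] by (simp add: card_insert_if)
  then have "\<not> C \<subseteq> insert x (nbrs A x)"
    using finite_nbrs by (meson card_mono finite.insertI leD)
  then obtain w where w: "w \<in> C" "w \<notin> insert x (nbrs A x)" by blast
  have sub: "insert x (nbrs A x) \<subseteq> C" using x nbrs_subset by blast
  obtain y z where "y \<in> insert x (nbrs A x)" "z \<notin> insert x (nbrs A x)" "A y z"
    using adj_connectedD[OF host_conn sub insertI1 w] by metis
  then show thesis using that[of x y z] by auto
qed

text \<open>A neighbor \<open>w\<close> of \<open>z\<close> that is not adjacent to \<open>x\<close>
  prolongs the path. If there is none, the neighborhood of \<open>z\<close> lies in that of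
  \<open>x\<close>, and regularity makes them equal.\<close>

lemma twin_or_path4:
  assumes "A x y" "A y z" "x \<noteq> z" "\<not> A x z"
  shows "nbrs A x = nbrs A z \<or>
    (\<exists>w. simple_path C A [x, y, z, w] \<and> \<not> A x w)"
proof (rule disjCI)
  assume no: "\<not> (\<exists>w. simple_path C A [x, y, z, w] \<and> \<not> A x w)"
  have "nbrs A z \<subseteq> nbrs A x"
  proof
    fix w assume "w \<in> nbrs A z"
    then have w: "A z w" by simp
    have "A x w"
    proof (rule ccontr)
      assume "\<not> A x w"
      moreover have "w \<noteq> x" "w \<noteq> y" "w \<noteq> z" "x \<noteq> y" "y \<noteq> z"
        using w assms(1,2,4) \<open>\<not> A x w\<close> adj_sym adj_neq by blast+
      ultimately have "simple_path C A [x, y, z, w]"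
        using assms w adj_in1 adj_in2 by (simp add: simple_path_def)
      then show False using no \<open>\<not> A x w\<close> by blast
    qed
    then show "w \<in> nbrs A x" by simp
  qed
  moreover have "card (nbrs A z) = card (nbrs A x)"
    using deg adj_in1[OF assms(1)] adj_in2[OF assms(2)] by simp
  ultimately show "nbrs A x = nbrs A z"
    using card_subset_eq[OF finite_nbrs, of "nbrs A z" x] by simp
qed

text \<open>
  If any two vertices at distance two are twins, then the graph is complete multipartite and its
  parts have \<open>card C - d \<ge> 3\<close> vertices.
\<close>

lemma host_dichotomy:
  assumes "d + 3 \<le> card C" "d \<ge> 1"
  obtains
    (path) x1 x2 x3 x4 where "simple_path C A [x1, x2, x3, x4]" "\<not> A x1 x3" "\<not> A x1 x4"
  | (multipartite) a1 a2 a3 b1 b2 b3 where "distinct [a1, a2, a3]" "distinct [b1, b2, b3]"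
      "\<And>a. a \<in> {a1, a2, a3} \<Longrightarrow> nbrs A a = nbrs A a1 \<and> {b1, b2, b3} \<subseteq> nbrs A a"
      "\<And>b. b \<in> {b1, b2, b3} \<Longrightarrow> nbrs A b = nbrs A b1 \<and> {a1, a2, a3} \<subseteq> nbrs A b"
      "{a1, a2, a3, b1, b2, b3} \<subseteq> C"
proof (cases "\<exists>x1 x2 x3 x4. simple_path C A [x1, x2, x3, x4] \<and> \<not> A x1 x3 \<and> \<not> A x1 x4")
  case True
  then show thesis using path by blast
next
  case False
  have twin: "nbrs A z = nbrs A x" if "A x y" "A y z" "x \<noteq> z" "\<not> A x z" for x y z
    using twin_or_path4[OF that] False that(4) by metis
  have part: "\<exists>b c. b \<in> C \<and> c \<in> C \<and> distinct [a, b, c] \<and> nbrs A b = nbrs A a \<and> nbrs A c = nbrs A a"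
    if a: "a \<in> C" for a
  proof -
    define P where "P = {z \<in> C. nbrs A z = nbrs A a}"
    \<comment> \<open>A vertex reached from \<open>a\<close> in two steps is adjacent to
      \<open>a\<close>, equal to \<open>a\<close>, or a twin of \<open>a\<close>. Hence the part
      \<open>P\<close> has at least \<open>card C - d\<close> vertices.\<close>
    have "nbrs A a \<union> P = C"
    proof (rule adj_connected_closed[OF host_conn])
      show "nbrs A a \<union> P \<subseteq> C" using nbrs_subset unfolding P_def by blast
      show "nbrs A a \<union> P \<noteq> {}" using a unfolding P_def by blast
      fix x y assume x: "x \<in> nbrs A a \<union> P" and y: "y \<in> C" and e: "A x y"
      show "y \<in> nbrs A a \<union> P"
      proof (cases "A a x")
        case True
        then show ?thesis using twin[OF True e] y a unfolding P_def by auto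
      next
        case False
        then have "nbrs A x = nbrs A a" using x unfolding P_def by auto
        then show ?thesis using e by (metis UnI1 in_nbrs)
      qed
    qed
    moreover have "finite P" using finite_V unfolding P_def by simp
    ultimately have "card C \<le> d + card P" using card_Un_le[of "nbrs A a" P] deg[OF a] by simp
    then have "3 \<le> card P" using assms(1) by linarith
    moreover have "a \<in> P" using a unfolding P_def by simp
    ultimately have "2 \<le> card (P - {a})" using \<open>finite P\<close> by (simp add: card_Diff_singleton)
    then have "P - {a} \<noteq> {}" by (metis card.empty not_numeral_le_zero)
    then obtain b where b: "b \<in> P - {a}" by blast
    have "1 \<le> card (P - {a} - {b})" using \<open>2 \<le> card (P - {a})\<close> \<open>finite P\<close> b
      by (simp add: card_Diff_singleton)
    then have "P - {a} - {b} \<noteq> {}" by (metis card.empty not_one_le_zero)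
    then obtain c where "c \<in> P - {a} - {b}" by blast
    then show ?thesis using b unfolding P_def by auto
  qed
  obtain a1 where a1: "a1 \<in> C" using assms(1) by fastforce
  then have "nbrs A a1 \<noteq> {}" using deg assms(2) by (metis card.empty not_one_le_zero)
  then obtain b1 where "b1 \<in> nbrs A a1" by blast
  then have ab: "A a1 b1" by simp
  then have b1: "b1 \<in> C" using adj_in2 by blast
  obtain a2 a3 where a: "a2 \<in> C" "a3 \<in> C" "distinct [a1, a2, a3]" "nbrs A a2 = nbrs A a1" "nbrs A a3 = nbrs A a1"
    using part[OF a1] by blast
  obtain b2 b3 where b: "b2 \<in> C" "b3 \<in> C" "distinct [b1, b2, b3]" "nbrs A b2 = nbrs A b1" "nbrs A b3 = nbrs A b1"
    using part[OF b1] by blast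
  have "a \<in> nbrs A b1" if "a \<in> {a1, a2, a3}" for a
  proof -
    have "nbrs A a = nbrs A a1" using that a by auto
    then have "A a b1" using ab by (metis in_nbrs)
    then show ?thesis using adj_sym by simp
  qed
  then have sub1: "{a1, a2, a3} \<subseteq> nbrs A b1" by blast
  then have "A b a1" if "b \<in> {b1, b2, b3}" for b
  proof -
    have "nbrs A b = nbrs A b1" using that b by auto
    then show ?thesis using sub1 by auto
  qed
  then have sub2: "{b1, b2, b3} \<subseteq> nbrs A a1" using adj_sym by auto
  show thesis
    by (rule multipartite[of a1 a2 a3 b1 b2 b3]) (use a b a1 b1 sub1 sub2 in auto)
qed

text \<open>Provides images for a center \<open>p\<close> and for three vertices around it in a
  double star: \<open>x\<close> for \<open>p\<close>, \<open>y\<close> for the other center, and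
  \<open>z\<close>, \<open>z'\<close> for two more neighbors of that center, both missed by
  \<open>x\<close>.\<close>

lemma obtain_two_outside_closed_nbrs:
  assumes "d + 3 \<le> card C" "d \<ge> 3"
  obtains x y z z' where "A x y" "A y z" "A y z'" "z \<noteq> z'" "z \<noteq> x" "z' \<noteq> x" "\<not> A x z" "\<not> A x z'"
proof -
  have "d \<ge> 1" using assms(2) by simp
  from assms(1) this show thesis
  proof (cases rule: host_dichotomy)
    case (path x1 x2 x3 x4)
    show thesis
    proof (rule ccontr)
      assume no: "\<not> thesis"
      \<comment> \<open>The negated goal: a neighbor of \<open>x\<close> has at most one neighbor
        outside the closed neighborhood of \<open>x\<close>.\<close>
      have one: "z = z'"
        if "A x y" "A y z" "A y z'" "z \<noteq> x" "z' \<noteq> x" "\<not> A x z" "\<not> A x z'" for x y z z'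
        using no \<open>\<And>x y z z'. \<lbrakk>A x y; A y z; A y z'; z \<noteq> z'; z \<noteq> x; z' \<noteq> x; \<not> A x z; \<not> A x z'\<rbrakk> \<Longrightarrow> thesis\<close>
          that by metis
      have e: "A x1 x2" "A x2 x3" "A x3 x4" "A x2 x1" "A x3 x2" "A x4 x3" "x3 \<in> C"
        "x1 \<noteq> x2" "x1 \<noteq> x3" "x1 \<noteq> x4" "x2 \<noteq> x3" "x2 \<noteq> x4" "x3 \<noteq> x4"
        using path(1) adj_sym by (auto simp: simple_path_def)
      \<comment> \<open>Since \<open>d\<close> is at least 3, \<open>x3\<close> has a third neighbor
        \<open>w\<close>. Applying \<open>one\<close> around the path determines its adjacencies:
        \<open>w\<close> is adjacent to \<open>x2\<close> and \<open>x1\<close> but not to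
        \<open>x4\<close>. Then \<open>x2\<close> and \<open>w\<close> contradict \<open>one\<close>
        for the neighbor \<open>x3\<close> of \<open>x4\<close>.\<close>
      have "card {x2, x4} < card (nbrs A x3)" using deg[OF e(7)] assms(2) by (auto simp: card_insert_if)
      then have "\<not> nbrs A x3 \<subseteq> {x2, x4}" by (meson card_mono finite.emptyI finite.insertI leD)
      then obtain w where "w \<in> nbrs A x3" "w \<notin> {x2, x4}" by blast
      then have w: "A x3 w" "w \<noteq> x2" "w \<noteq> x4" by auto
      have x24: "\<not> A x2 x4" using one[of x1 x2 x3 x4] e path by metis
      have "w \<noteq> x1" using w path(2) adj_sym by blast
      have "A x2 w" using one[of x2 x3 x4 w] e w x24 by metis
      then have "A x1 w" using one[of x1 x2 x3 w] e \<open>w \<noteq> x1\<close> w adj_irrefl path(2) by metis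
      then have "\<not> A w x4" using one[of x1 w x3 x4] e path w adj_sym[of x3 w] by metis
      then show False using one[of x4 x3 x2 w] e w x24 adj_sym[of x4] by metis
    qed
  next
    case (multipartite a1 a2 a3 b1 b2 b3)
    have "A a1 b1" "A b1 a2" "A b1 a3" using multipartite(3)[of a1] multipartite(4)[of b1] by auto
    moreover have "\<not> A a1 a2" "\<not> A a1 a3"
      using multipartite(3)[of a2] multipartite(3)[of a3] adj_irrefl by (metis in_nbrs insertCI)+
    ultimately show thesis using that[of a1 b1 a2 a3] multipartite(1) by auto
  qed
qed

text \<open>The image \<open>I\<close> of the tree without its two leaves, or without its one leaf,
  has one vertex more than \<open>x\<close> has neighbors. In the applications \<open>Z\<close>
  contains \<open>x\<close> itself, so each further vertex of \<open>I\<close> missed by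
  \<open>x\<close> guarantees one neighbor outside \<open>I\<close>.\<close>

lemma free_nbrs:
  assumes "I \<subseteq> C" "card I = d + 1" "x \<in> C" "Z \<subseteq> I" "\<And>z. z \<in> Z \<Longrightarrow> \<not> A x z"
  shows "card Z \<le> card (nbrs A x - I) + 1"
proof -
  have fin: "finite I" using assms(1) finite_V finite_subset by blast
  have "card (nbrs A x \<inter> I) \<le> card (I - Z)"
    using fin assms(5) by (intro card_mono) auto
  also have "\<dots> = d + 1 - card Z" using assms(2,4) fin finite_subset[OF assms(4) fin] by (simp add: card_Diff_subset)
  finally have "card (nbrs A x \<inter> I) \<le> d + 1 - card Z" .
  moreover have "card (nbrs A x - I) = d - card (nbrs A x \<inter> I)"
    using deg[OF assms(3)] finite_nbrs by (simp add: card_Diff_subset_Int)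
  moreover have "card Z \<le> d + 1" using card_mono[OF fin assms(4)] assms(2) by simp
  ultimately show ?thesis by linarith
qed

text \<open>The head and the last vertex are to carry one leaf each. Missing two path vertices gives
  the head two free neighbors in the end, so that one of them differs from the free neighbor chosen
  for the last vertex.\<close>

definition good_path :: "'b list \<Rightarrow> bool" where
  "good_path xs \<longleftrightarrow> simple_path C A xs \<and>
     (\<exists>z \<in> set xs - {last xs}. \<not> A (last xs) z) \<and>
     (\<exists>z \<in> set xs - {hd xs}. \<exists>z' \<in> set xs - {hd xs}. z \<noteq> z' \<and> \<not> A (hd xs) z \<and> \<not> A (hd xs) z')"

lemma good_pathI:
  assumes "simple_path C A xs" "z \<in> set xs" "z \<noteq> last xs" "\<not> A (last xs) z"
    and "w \<in> set xs" "w' \<in> set xs" "w \<noteq> hd xs" "w' \<noteq> hd xs" "w \<noteq> w'"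
    and "\<not> A (hd xs) w" "\<not> A (hd xs) w'"
  shows "good_path xs"
  using assms unfolding good_path_def by blast

text \<open>The last vertex has a neighbor \<open>y\<close> off the path. If \<open>y\<close> misses
  some path vertex, it becomes the new last vertex; otherwise it is adjacent to all of them and fits
  right after the head, leaving both ends unchanged.\<close>

lemma good_path_grow:
  assumes "good_path xs" "length xs \<le> d"
  shows "\<exists>ys. good_path ys \<and> length ys = Suc (length xs)"
proof -
  have p: "simple_path C A xs" and ne: "xs \<noteq> []"
    using assms(1) by (auto simp: good_path_def simple_path_def)
  obtain z where z: "z \<in> set xs" "z \<noteq> last xs" "\<not> A (last xs) z"
    using assms(1) by (auto simp: good_path_def)
  obtain w w' where w: "w \<in> set xs" "w' \<in> set xs" "w \<noteq> hd xs" "w' \<noteq> hd xs" "w \<noteq> w'"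
    "\<not> A (hd xs) w" "\<not> A (hd xs) w'"
    using assms(1) by (auto simp: good_path_def)
  have l: "last xs \<in> C" using p ne by (auto simp: simple_path_def)
  have "card (set xs - {last xs}) < card (nbrs A (last xs))"
    using deg[OF l] assms(2) p ne by (auto simp: simple_path_def distinct_card card_Diff_singleton)
      (metis Suc_pred length_greater_0_conv less_eq_Suc_le)
  then have "\<not> nbrs A (last xs) \<subseteq> set xs - {last xs}" by (meson card_mono finite_Diff finite_set leD)
  then obtain y where "y \<in> nbrs A (last xs)" "y \<notin> set xs - {last xs}" by blast
  then have y: "A (last xs) y" "y \<notin> set xs" using adj_neq by auto
  show ?thesis
  proof (cases "\<exists>v \<in> set xs. \<not> A y v")
    case True
    then obtain v where v: "v \<in> set xs" "\<not> A y v" by blast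
    have "simple_path C A (xs @ [y])"
      using p y adj_in2 by (auto simp: simple_path_def successively_append_iff)
    then have "good_path (xs @ [y])"
      by (rule good_pathI[of _ v w w']) (use w v y ne in auto)
    then show ?thesis by force
  next
    case False
    obtain x x' xs' where xs: "xs = x # x' # xs'"
      using z ne by (cases xs; cases "tl xs") auto
    define ys where "ys = x # y # x' # xs'"
    have "simple_path C A ys"
      using p y False adj_in2[OF y(1)] adj_sym unfolding ys_def xs by (auto simp: simple_path_def)
    moreover have "hd ys = hd xs" "last ys = last xs" "set ys = insert y (set xs)"
      unfolding ys_def xs by auto
    ultimately have "good_path ys"
      by (intro good_pathI[of _ z w w']) (use w z in auto)
    then show ?thesis unfolding ys_def xs by force
  qed
qed

lemma good_path_of_length:
  assumes "good_path xs" "length xs \<le> k" "k \<le> d + 1"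
  shows "\<exists>ys. good_path ys \<and> length ys = k"
  using assms(2,3)
proof (induction k rule: dec_induct)
  case (step k)
  then show ?case using good_path_grow by (metis Suc_eq_plus1 Suc_leD Suc_le_mono)
qed (use assms(1) in blast)

end

section \<open>Embedding trees into regular graphs\<close>

lemma (in adj_graph) embedding_complement_leaves:
  assumes "leaf E l p" "leaf E l' p'" "l \<noteq> l'" "p \<noteq> l'" "p' \<noteq> l"
    and f: "embedding E (V - {l, l'}) A C f"
    and y: "A (f p) y" "A (f p') y'" "y \<noteq> y'" "y \<notin> f ` (V - {l, l'})" "y' \<notin> f ` (V - {l, l'})"
    and A: "adj_graph C A"
  shows "\<exists>g. embedding E V A C g"
proof -
  interpret H: adj_graph C A by fact
  have l: "E l w \<longleftrightarrow> w = p" "E w l \<longleftrightarrow> w = p" for w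
    using assms(1) adj_sym unfolding leaf_def set_eq_iff by auto
  have l': "E l' w \<longleftrightarrow> w = p'" "E w l' \<longleftrightarrow> w = p'" for w
    using assms(2) adj_sym unfolding leaf_def set_eq_iff by auto
  have V: "l \<in> V" "l' \<in> V" using l(1) l'(1) adj_in1 by blast+
  have sym: "A y (f p)" "A y' (f p')" and C: "y \<in> C" "y' \<in> C"
    using y H.adj_sym H.adj_in2 by blast+
  define g where "g = f(l := y)"
  have g: "embedding E (insert l (V - {l, l'})) A C g" unfolding g_def
    by (rule embedding_insert[OF f]) (use y sym C l adj_irrefl in auto)
  have "embedding E (insert l' (insert l (V - {l, l'}))) A C (g(l' := y'))"
    by (rule embedding_insert[OF g]) (use y sym C l' adj_irrefl assms(3,5) in \<open>auto simp: g_def\<close>)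
  moreover have "insert l' (insert l (V - {l, l'})) = V" using V by auto
  ultimately show ?thesis by auto
qed

text \<open>Only one leaf \<open>l\<close> is withheld. Its parent is sent to an end of an induced
  path and so misses the other end, which leaves one free neighbor for \<open>l\<close>.\<close>

lemma (in adj_tree) embedding_of_path4_tree:
  assumes "regular_host C A d" "card V = d + 2" "d + 2 \<le> card C" "simple_path V E [a, b, c, e]"
  shows "\<exists>f. embedding E V A C f"
proof -
  interpret H: regular_host C A d by fact
  have "V \<noteq> {}" using assms(2) by auto
  then obtain xs where xs: "simple_path V E xs" "\<And>ys. simple_path V E ys \<Longrightarrow> length ys \<le> length xs"
    using longest_path by blast
  have "length xs \<ge> 4" using xs(2)[OF assms(4)] by simp
  then obtain l p q r rest where q: "xs = l # p # q # r # rest"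
    by (auto simp: numeral_eq_Suc Suc_le_length_iff)
  have l: "leaf E l p" using leaf_end_of_longest_path xs unfolding q by blast
  have pqr: "simple_path V E [p, q, r]" "l \<notin> {p, q, r}" "{p, q, r} \<subseteq> V" "l \<in> V"
    using xs(1) unfolding q by (auto simp: simple_path_def)
  obtain x y z where xyz: "A x y" "A y z" "x \<noteq> z" "\<not> A x z"
    using H.obtain_induced_path3[OF assms(3)] by blast
  have "simple_path C A [x, y, z]"
    using xyz H.adj_neq H.adj_in1 H.adj_in2 by (simp add: simple_path_def)
  then obtain f where f: "embedding E (set [p, q, r]) A C f" "map f [p, q, r] = [x, y, z]"
    using embedding_path[OF H.adj_graph_axioms pqr(1), where xs = "[x, y, z]"] by auto
  have card: "card (V - {l}) = d + 1" using assms(2) pqr(4) finite_V by simp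
  obtain g where g: "embedding E (V - {l}) A C g" "\<forall>v \<in> set [p, q, r]. g v = f v"
    using embedding_greedy[OF H.adj_graph_axioms adj_connected_remove_leaf[OF conn l] _ _ f(1)
        adj_connected_simple_path[OF pqr(1)]] card H.deg pqr by auto
  have gp: "g p = x" "g r = z" using f(2) g(2) by auto
  have I: "g ` (V - {l}) \<subseteq> C" "card (g ` (V - {l})) = d + 1"
    using g(1) card by (auto simp: embedding_def card_image)
  have "{x, z} \<subseteq> g ` (V - {l})" using gp pqr by (auto simp flip: gp)
  then have "card {x, z} \<le> card (nbrs A x - g ` (V - {l})) + 1"
    using H.free_nbrs[OF I, of x "{x, z}"] xyz H.adj_irrefl H.adj_in1[OF xyz(1)] by blast
  then have "1 \<le> card (nbrs A x - g ` (V - {l}))" using xyz(3) by simp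
  then have "nbrs A x - g ` (V - {l}) \<noteq> {}" by (metis card.empty not_one_le_zero)
  then obtain w where "w \<in> nbrs A x - g ` (V - {l})" by blast
  then have w: "A x w" "w \<notin> g ` (V - {l})" by auto
  have lE: "E l v \<Longrightarrow> v = p" "E v l \<Longrightarrow> v = p" for v
    using leafD(6)[OF l] adj_sym by blast+
  have "embedding E (insert l (V - {l})) A C (g(l := w))"
  proof (rule embedding_insert[OF g(1)])
    show "A w (g v)" if "E l v" for v using lE(1)[OF that] gp w H.adj_sym by simp
    show "A (g v) w" if "E v l" for v using lE(2)[OF that] gp w by simp
  qed (use w H.adj_in2[OF w(1)] adj_irrefl in auto)
  moreover have "insert l (V - {l}) = V" using pqr(4) by auto
  ultimately show ?thesis by auto
qed

section \<open>Trees on \<open>d + 3\<close> vertices in connected \<open>d\<close>-regular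
  hosts\<close>

context adj_tree
begin

lemma extend_off_leaves:
  assumes "regular_host C A d" "card V = d + 3"
    and l: "leaf E l p" "leaf E l' p'" "l \<noteq> l'" "p' \<noteq> l"
    and S: "adj_connected E S" "S \<noteq> {}" "S \<subseteq> V - {l, l'}" "embedding E S A C f"
  obtains g where "embedding E (V - {l, l'}) A C g" "\<And>v. v \<in> S \<Longrightarrow> g v = f v"
    "g ` (V - {l, l'}) \<subseteq> C" "card (g ` (V - {l, l'})) = d + 1"
proof -
  interpret H: regular_host C A d by fact
  have V: "l \<in> V" "l' \<in> V" using l leafD by blast+
  have eq: "V - {l} - {l'} = V - {l, l'}" by auto
  have conn': "adj_connected E (V - {l, l'})"
    using adj_connected_remove_leaf[OF adj_connected_remove_leaf[OF conn l(1)] l(2)] unfolding eq .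
  have card: "card (V - {l, l'}) = d + 1" using assms(2) V l(3) finite_V by (simp add: card_Diff_subset)
  obtain g where g: "embedding E (V - {l, l'}) A C g" "\<forall>v \<in> S. g v = f v"
    using embedding_greedy[OF H.adj_graph_axioms conn' _ _ S(4,1,2,3)] card H.deg by auto
  then show thesis using that[of g] card by (auto simp: embedding_def card_image)
qed

text \<open>The common last step of all cases: \<open>f p\<close> misses two image vertices and
  \<open>f p'\<close> misses one, which survives the greedy extension and frees neighbors for both
  leaves. The parents may coincide, as in the double star.\<close>

lemma embedding_from_nonadjacent:
  assumes "regular_host C A d" "card V = d + 3"
    and l: "leaf E l p" "leaf E l' p'" "l \<noteq> l'"
    and S: "adj_connected E S" "S \<subseteq> V - {l, l'}" "embedding E S A C f" "p \<in> S" "p' \<in> S"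
    and z: "z \<in> f ` S" "z' \<in> f ` S" "z \<noteq> z'" "z \<noteq> f p" "z' \<noteq> f p" "\<not> A (f p) z" "\<not> A (f p) z'"
    and w: "w \<in> f ` S" "w \<noteq> f p'" "\<not> A (f p') w"
  shows "\<exists>g. embedding E V A C g"
proof -
  interpret H: regular_host C A d by fact
  have ne: "p \<noteq> l'" "p' \<noteq> l" "S \<noteq> {}" using S by auto
  obtain g where g: "embedding E (V - {l, l'}) A C g" "\<And>v. v \<in> S \<Longrightarrow> g v = f v"
    and I: "g ` (V - {l, l'}) \<subseteq> C" "card (g ` (V - {l, l'})) = d + 1"
    using extend_off_leaves[OF assms(1,2) l ne(2) S(1) ne(3) S(2,3)] by blast
  let ?I = "g ` (V - {l, l'})"
  have sub: "f ` S \<subseteq> ?I" using g(2) S(2) by force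
  have gp: "g p = f p" "g p' = f p'" using g(2) S by auto
  have C: "f p \<in> C" "f p' \<in> C" using S(3-5) by (auto simp: embedding_def)
  have "{f p, z, z'} \<subseteq> ?I" "{f p', w} \<subseteq> ?I" using sub z w S(4,5) by auto
  then have "card {f p, z, z'} \<le> card (nbrs A (f p) - ?I) + 1"
    "card {f p', w} \<le> card (nbrs A (f p') - ?I) + 1"
    using H.free_nbrs[OF I C(1), of "{f p, z, z'}"] H.free_nbrs[OF I C(2), of "{f p', w}"]
      z w H.adj_irrefl by auto
  then have c: "2 \<le> card (nbrs A (f p) - ?I)" "1 \<le> card (nbrs A (f p') - ?I)"
    using z(3,4,5) w(2) by auto
  then have "nbrs A (f p') - ?I \<noteq> {}" by (metis card.empty not_one_le_zero)
  then obtain y' where "y' \<in> nbrs A (f p') - ?I" by blast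
  then have y': "A (f p') y'" "y' \<notin> ?I" by auto
  \<comment> \<open>The single choice for \<open>l'\<close> is fixed first; of the two choices for
    \<open>l\<close>, one remains.\<close>
  have "1 \<le> card (nbrs A (f p) - ?I - {y'})"
    using c(1) diff_card_le_card_Diff[of "{y'}" "nbrs A (f p) - ?I"] by simp
  then have "nbrs A (f p) - ?I - {y'} \<noteq> {}" by (metis card.empty not_one_le_zero)
  then obtain y where "y \<in> nbrs A (f p) - ?I - {y'}" by blast
  then have "A (f p) y" "y \<notin> ?I" "y \<noteq> y'" by auto
  then show ?thesis
    using embedding_complement_leaves[OF l ne(1,2) g(1), of y y'] y' gp H.adj_graph_axioms by auto
qed

lemma embedding_good_path:
  assumes "regular_host C A d" "card V = d + 3"
    and l: "leaf E l (hd vs)" "leaf E l' (last vs)" "l \<noteq> l'"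
    and vs: "simple_path V E vs" "l \<notin> set vs" "l' \<notin> set vs"
    and xs: "regular_host.good_path C A xs" "length vs = length xs"
  shows "\<exists>g. embedding E V A C g"
proof -
  interpret H: regular_host C A d by fact
  have p: "simple_path C A xs" using xs(1) unfolding H.good_path_def by blast
  obtain f where f: "embedding E (set vs) A C f" "map f vs = xs"
    using embedding_path[OF H.adj_graph_axioms vs(1) p xs(2)] by blast
  have ne: "vs \<noteq> []" "set vs \<subseteq> V" using vs(1) by (auto simp: simple_path_def)
  have fs: "f ` set vs = set xs" "f (hd vs) = hd xs" "f (last vs) = last xs"
    using f(2) ne by (auto simp: hd_map last_map)
  have sub: "set vs \<subseteq> V - {l, l'}" using ne vs by auto
  obtain z where z: "z \<in> set xs" "z \<noteq> last xs" "\<not> A (last xs) z"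
    using xs(1) by (auto simp: H.good_path_def)
  obtain w w' where w: "w \<in> set xs" "w' \<in> set xs" "w \<noteq> w'" "w \<noteq> hd xs" "w' \<noteq> hd xs"
    "\<not> A (hd xs) w" "\<not> A (hd xs) w'"
    using xs(1) by (auto simp: H.good_path_def)
  show ?thesis
    using embedding_from_nonadjacent[OF assms(1,2) l adj_connected_simple_path[OF vs(1)] _ f(1),
        of w w' z] sub ne z w unfolding fs by simp
qed

text \<open>Both leaves hang at \<open>p\<close>, whose image misses the images of \<open>r\<close>
  and \<open>r'\<close>; this serves both leaf conditions at once.\<close>

lemma embedding_double_star:
  assumes "regular_host C A d" "card V = d + 3" "d + 3 \<le> card C"
    and l: "leaf E l p" "leaf E l' p" "l \<noteq> l'"
    and q: "simple_path V E [p, q, r]" "E q r'" "r' \<noteq> p" "r' \<noteq> r" "q \<noteq> l" "q \<noteq> l'"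
  shows "\<exists>g. embedding E V A C g"
proof -
  interpret H: regular_host C A d by fact
  have e: "E p q" "E q r" "p \<noteq> q" "p \<noteq> r" "q \<noteq> r" "q \<noteq> r'" "{p, q, r, r'} \<subseteq> V"
    using q adj_neq adj_in2 by (auto simp: simple_path_def)
  have off: "v \<noteq> l \<and> v \<noteq> l'" if "E q v" "v \<noteq> p" for v
    using leafD(6)[OF l(1)] leafD(6)[OF l(2)] adj_sym[OF that(1)] e(3) by blast
  have nl: "l \<noteq> p" "l' \<noteq> p" "l \<in> V" "l' \<in> V" using leafD l by blast+
  \<comment> \<open>Six distinct vertices in a tree on \<open>d + 3\<close> vertices force
    \<open>d\<close> to be at least 3.\<close>
  have "{l, l', p, q, r, r'} \<subseteq> V" using e nl by auto
  then have "card {l, l', p, q, r, r'} \<le> card V" using finite_V card_mono by blast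
  moreover have "card {l, l', p, q, r, r'} = 6"
    using off[of r] off[of r'] e q nl l(3) by auto
  ultimately have d3: "d \<ge> 3" using assms(2) by simp
  obtain x y z z' where x: "A x y" "A y z" "A y z'" "z \<noteq> z'" "z \<noteq> x" "z' \<noteq> x" "\<not> A x z" "\<not> A x z'"
    using H.obtain_two_outside_closed_nbrs[OF assms(3) d3] by blast
  have "simple_path C A [x, y, z]" using x H.adj_neq H.adj_in1 H.adj_in2 by (auto simp: simple_path_def)
  then obtain f where f: "embedding E (set [p, q, r]) A C f" "map f [p, q, r] = [x, y, z]"
    using embedding_path[OF H.adj_graph_axioms q(1), where xs = "[x, y, z]"] by auto
  define f' where "f' = f(r' := z')"
  have f': "embedding E (insert r' (set [p, q, r])) A C f'" unfolding f'_def
    using f(2) x q e H.adj_sym H.adj_in2[OF x(3)] H.adj_neq[OF x(3)]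
    by (intro embedding_extend[OF f(1) adj_connected_simple_path[OF q(1)], of q]) auto
  have im: "f' p = x" "f' q = y" "f' r = z" "f' r' = z'"
    using f(2) q e unfolding f'_def by auto
  have conn': "adj_connected E (insert r' (set [p, q, r]))"
    using adj_connected_insert[OF adj_connected_simple_path[OF q(1)], of q r'] q(2) adj_sym by auto
  have sub: "insert r' (set [p, q, r]) \<subseteq> V - {l, l'}"
    using off[of r] off[of r'] e q nl by auto
  show ?thesis
    by (rule embedding_from_nonadjacent[OF assms(1,2) l conn' sub f', of z z' z])
       (use x in \<open>simp_all add: im\<close>)
qed

text \<open>In the path case \<open>x1\<close> and \<open>x3\<close> miss only each other for
  certain, so each has a free neighbor but the two may coincide; this must be excluded separately.
  In the multipartite case the extra neighbor \<open>u\<close> of \<open>g\<close> is sent to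
  \<open>a3\<close>, the second vertex missed by the image of \<open>p\<close>.\<close>

lemma embedding_spider:
  assumes "regular_host C A d" "card V = d + 3" "d + 3 \<le> card C" "d \<ge> 1"
    and l: "leaf E l p" "leaf E l' p'"
    and g: "simple_path V E [l, p, g, p', l']" "E g u" "u \<noteq> p" "u \<noteq> p'"
  shows "\<exists>h. embedding E V A C h"
proof -
  interpret H: regular_host C A d by fact
  have pgp: "simple_path V E [p, g, p']" using g(1) by (simp add: simple_path_def)
  have e: "E p g" "E g p'" "distinct [l, p, g, p', l']" "{l, p, g, p', l', u} \<subseteq> V"
    using g adj_in2 by (auto simp: simple_path_def)
  then have ll': "l \<noteq> l'" "p \<noteq> l'" "p' \<noteq> l" by auto
  have u: "u \<noteq> l" "u \<noteq> l'" "u \<noteq> g"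
    using leafD(6)[OF l(1), of g] leafD(6)[OF l(2), of g] adj_sym[OF g(2)] adj_neq[OF g(2)] e(3) by auto
  have S: "adj_connected E (set [p, g, p'])" using adj_connected_simple_path[OF pgp] .
  from assms(3,4) show ?thesis
  proof (cases rule: H.host_dichotomy)
    case (path x1 x2 x3 x4)
    have x: "A x1 x2" "A x2 x3" "A x3 x4" "x1 \<noteq> x3" "x1 \<in> C" "x3 \<in> C" "simple_path C A [x1, x2, x3]"
      using path(1) by (auto simp: simple_path_def)
    obtain f where f: "embedding E (set [p, g, p']) A C f" "map f [p, g, p'] = [x1, x2, x3]"
      using embedding_path[OF H.adj_graph_axioms pgp x(7)] by auto
    obtain h where h: "embedding E (V - {l, l'}) A C h" "\<And>v. v \<in> set [p, g, p'] \<Longrightarrow> h v = f v"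
      and I: "h ` (V - {l, l'}) \<subseteq> C" "card (h ` (V - {l, l'})) = d + 1"
      using extend_off_leaves[OF assms(1,2) l ll'(1,3) S _ _ f(1)] e by auto
    let ?I = "h ` (V - {l, l'})"
    have hp: "h p = x1" "h p' = x3" using h(2) f(2) by auto
    have sub: "{x1, x3} \<subseteq> ?I" using e by (auto simp flip: hp)
    have n13: "\<not> A x1 z" "\<not> A x3 z" if "z \<in> {x1, x3}" for z
      using that path(2) H.adj_irrefl H.adj_sym by auto
    have "card {x1, x3} \<le> card (nbrs A x1 - ?I) + 1" "card {x1, x3} \<le> card (nbrs A x3 - ?I) + 1"
      using H.free_nbrs[OF I x(5) sub] H.free_nbrs[OF I x(6) sub] n13 by blast+
    then have "1 \<le> card (nbrs A x1 - ?I)" "1 \<le> card (nbrs A x3 - ?I)" using x(4) by auto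
    then have "nbrs A x1 - ?I \<noteq> {}" "nbrs A x3 - ?I \<noteq> {}" by (metis card.empty not_one_le_zero)+
    then obtain y y3 where "y \<in> nbrs A x1 - ?I" "y3 \<in> nbrs A x3 - ?I" by blast
    then have y: "A x1 y" "y \<notin> ?I" "A x3 y3" "y3 \<notin> ?I" by auto
    show ?thesis
    proof (cases "\<exists>y y'. A x1 y \<and> A x3 y' \<and> y \<noteq> y' \<and> y \<notin> ?I \<and> y' \<notin> ?I")
      case True
      then show ?thesis
        using embedding_complement_leaves[OF l ll' h(1)] hp H.adj_graph_axioms by auto
    next
      case False
      \<comment> \<open>Both image vertices miss the same single neighbour, hence are twins.\<close>
      have fin: "finite (insert y (?I - {x1, x3}))" using finite_V by simp
      have card: "card (insert y (?I - {x1, x3})) = d"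
        using I(2) sub x(4) y(2) finite_V assms(4) by (simp add: card_Diff_subset)
      have only: "w = y" if "A x1 w \<or> A x3 w" "w \<notin> ?I" for w
        using False y that by metis
      have "w \<in> insert y (?I - {x1, x3})" if "A x1 w \<or> A x3 w" for w
        using only[OF that] n13[of w] that by auto
      then have "nbrs A x1 \<subseteq> insert y (?I - {x1, x3})" "nbrs A x3 \<subseteq> insert y (?I - {x1, x3})"
        unfolding nbrs_def by blast+
      then have "nbrs A x1 = nbrs A x3"
        using card_subset_eq[OF fin] H.deg x(5,6) card by metis
      \<comment> \<open>\<open>x4\<close> is adjacent to \<open>x3\<close> but not to
        \<open>x1\<close>.\<close>
      then show ?thesis using x(3) path(3) by (metis in_nbrs)
    qed
  next
    case (multipartite a1 a2 a3 b1 b2 b3)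
    have a: "A a b1" "A b1 a" "a \<in> C" "a \<noteq> b1" if "a \<in> {a1, a2, a3}" for a
    proof -
      show "A b1 a" using multipartite(4)[of b1] that by auto
      then show "A a b1" "a \<in> C" "a \<noteq> b1" using H.adj_sym H.adj_in2 H.adj_neq by blast+
    qed
    have na: "\<not> A a a'" if "a \<in> {a1, a2, a3}" "a' \<in> {a1, a2, a3}" for a a'
      using multipartite(3)[OF that(1)] multipartite(3)[OF that(2)] H.adj_irrefl by (metis in_nbrs)
    have "simple_path C A [a1, b1, a2]"
      using a[of a1] a[of a2] multipartite(1,5) by (simp add: simple_path_def)
    then obtain f where f: "embedding E (set [p, g, p']) A C f" "map f [p, g, p'] = [a1, b1, a2]"
      using embedding_path[OF H.adj_graph_axioms pgp, where xs = "[a1, b1, a2]"] by auto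
    define f' where "f' = f(u := a3)"
    have f': "embedding E (insert u (set [p, g, p'])) A C f'" unfolding f'_def
      using f(2) a[of a3] multipartite(1) g u e
      by (intro embedding_extend[OF f(1) S, of g]) auto
    have im: "f' p = a1" "f' g = b1" "f' p' = a2" "f' u = a3"
      using f(2) g u unfolding f'_def by auto
    have conn': "adj_connected E (insert u (set [p, g, p']))"
      using adj_connected_insert[OF S, of g u] g(2) adj_sym by auto
    have sub: "insert u (set [p, g, p']) \<subseteq> V - {l, l'}" using e u by auto
    show ?thesis
      by (rule embedding_from_nonadjacent[OF assms(1,2) l ll'(1) conn' sub f', of a2 a3 a1])
         (use na multipartite(1) in \<open>auto simp: im\<close>)
  qed
qed

text \<open>The inner path \<open>vs\<close> is sent to a good path of the same length, grown from a
  short one. Only multipartite hosts with four inner vertices need a separate construction, as an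
  alternating path on four vertices is not good.\<close>

lemma embedding_long:
  assumes "regular_host C A d" "card V = d + 3" "d + 3 \<le> card C"
    and l: "leaf E l (hd vs)" "leaf E l' (last vs)"
    and vs: "simple_path V E (l # vs @ [l'])" "length vs \<ge> 4"
  shows "\<exists>g. embedding E V A C g"
proof -
  interpret H: regular_host C A d by fact
  have ll': "l \<noteq> l'" "l \<notin> set vs" "l' \<notin> set vs" "l \<in> V" "l' \<in> V"
    and p: "simple_path V E vs"
    using vs by (auto simp: simple_path_def successively_append_iff successively_Cons)
  have card: "card (V - {l, l'}) = d + 1"
    using assms(2) ll' finite_V by (simp add: card_Diff_subset)
  have sub: "set vs \<subseteq> V - {l, l'}" using p ll' by (auto simp: simple_path_def)
  have "card (set vs) \<le> d + 1" using card_mono[OF _ sub] finite_V card by auto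
  then have len: "length vs \<le> d + 1" using p by (simp add: simple_path_def distinct_card)
  have good: ?thesis if "H.good_path xs" "length xs \<le> length vs" for xs
    using H.good_path_of_length[OF that len] embedding_good_path[OF assms(1,2) l ll'(1) p ll'(2,3)] by auto
  have "d \<ge> 1" using len vs(2) by simp
  from assms(3) this show ?thesis
  proof (cases rule: H.host_dichotomy)
    case (path x1 x2 x3 x4)
    have "x1 \<noteq> x3" "x1 \<noteq> x4" "x3 \<noteq> x4" "\<not> A x4 x1"
      using path H.adj_sym by (auto simp: simple_path_def)
    then have "H.good_path [x1, x2, x3, x4]"
      by (intro H.good_pathI[OF path(1), of x1 x3 x4]) (use path in auto)
    then show ?thesis using good vs(2) by force
  next
    case (multipartite a1 a2 a3 b1 b2 b3)
    have ab: "A a b" "A b a" "a \<noteq> b" "a \<in> C" "b \<in> C" if "a \<in> {a1, a2, a3}" "b \<in> {b1, b2, b3}" for a b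
    proof -
      show "A a b" using multipartite(3) that by auto
      then show "A b a" "a \<noteq> b" "a \<in> C" "b \<in> C" using H.adj_sym H.adj_neq H.adj_in1 by blast+
    qed
    have na: "\<not> A a a'" if "a \<in> {a1, a2, a3}" "a' \<in> {a1, a2, a3}" for a a'
      using multipartite(3)[OF that(1)] multipartite(3)[OF that(2)] H.adj_irrefl by (metis in_nbrs)
    have nb: "\<not> A b b'" if "b \<in> {b1, b2, b3}" "b' \<in> {b1, b2, b3}" for b b'
      using multipartite(4)[OF that(1)] multipartite(4)[OF that(2)] H.adj_irrefl by (metis in_nbrs)
    have adj_ab: "A a1 b1" "A b1 a2" "A a2 b2" "A b2 a3"
      by (rule ab; simp)+
    have neq_ab: "a1 \<noteq> b1" "a1 \<noteq> b2" "a2 \<noteq> b1" "a2 \<noteq> b2" "a3 \<noteq> b1" "a3 \<noteq> b2"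
      by (rule ab; simp)+
    show ?thesis
    proof (cases "length vs \<ge> 5")
      case True
      \<comment> \<open>Both ends lie in the same part: the head misses \<open>a2\<close> and
        \<open>a3\<close>, the last vertex misses \<open>a1\<close>.\<close>
      have sp: "simple_path C A [a1, b1, a2, b2, a3]"
        using multipartite(1,2,5) adj_ab neq_ab by (auto simp: simple_path_def)
      have "H.good_path [a1, b1, a2, b2, a3]"
        by (rule H.good_pathI[OF sp, of a1 a2 a3]) (use na multipartite(1) in auto)
      then show ?thesis using good True by force
    next
      case False
      then have "length vs = 4" using vs(2) by simp
      then obtain v1 v2 v3 v4 where v: "vs = [v1, v2, v3, v4]"
        by (auto simp: numeral_eq_Suc length_Suc_conv)
      have sp: "simple_path C A [a1, b1, a2, b2]"
        using multipartite(1,2,5) adj_ab neq_ab by (auto simp: simple_path_def)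
      obtain f where f: "embedding E (set vs) A C f" "map f vs = [a1, b1, a2, b2]"
        using embedding_path[OF H.adj_graph_axioms p sp] v by auto
      have im: "f v1 = a1" "f v2 = b1" "f v3 = a2" "f v4 = b2" using f(2) unfolding v by auto
      have conn_vs: "adj_connected E (set vs)" using adj_connected_simple_path[OF p] .
      show ?thesis
      proof (cases "V - {l, l'} = set vs")
        case True
        have ne: "b3 \<notin> {a1, b1, a2, b2}" "a3 \<notin> {a1, b1, a2, b2}" "b3 \<noteq> a3" "A a1 b3" "A b2 a3"
          using ab[of a1 b3] ab[of a2 b3] ab[of a3 b1] ab[of a3 b2] ab[of a3 b3] multipartite(1,2) by auto
        have f0: "embedding E (V - {l, l'}) A C f" using True f(1) by simp
        have im0: "f ` (V - {l, l'}) = {a1, b1, a2, b2}" using True im unfolding v by auto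
        show ?thesis
          by (rule embedding_complement_leaves[OF l ll'(1) _ _ f0, where y = b3 and y' = a3])
             (use ne ll'(2,3) im H.adj_graph_axioms in \<open>auto simp: im0 v\<close>)
      next
        case False
        have conn': "adj_connected E (V - {l, l'})"
          using adj_connected_remove_leaf[OF adj_connected_remove_leaf[OF conn l(1)] l(2)]
          by (simp add: insert_commute flip: Diff_insert)
        obtain w u where wu: "w \<in> set vs" "u \<in> V - {l, l'}" "u \<notin> set vs" "E w u"
          using False sub conn' v unfolding adj_connected_def
          by (metis DiffD1 DiffD2 list.set_intros(1) empty_iff)
        have vd: "v1 \<noteq> v2" "v1 \<noteq> v3" "v1 \<noteq> v4" "v2 \<noteq> v3" "v2 \<noteq> v4" "v3 \<noteq> v4"
          using p unfolding v by (auto simp: simple_path_def)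
        have uv: "u \<noteq> v1" "u \<noteq> v2" "u \<noteq> v3" "u \<noteq> v4" using wu(3) unfolding v by auto
        have conn_u: "adj_connected E (insert u (set vs))"
          using adj_connected_insert[OF conn_vs wu(1,4)] adj_sym wu(4) by blast
        have sub_u: "insert u (set vs) \<subseteq> V - {l, l'}" "insert u (set vs) \<subseteq> V - {l', l}"
          using sub wu(2) by auto
        \<comment> \<open>The ends of the path miss one path vertex each. Sending the additional
          vertex \<open>u\<close> to \<open>b3\<close> or \<open>a3\<close>, in the part opposite to
          the image of \<open>w\<close>, gives a second missed vertex to \<open>v4\<close> or to
          \<open>v1\<close>. In the first case the two leaves therefore exchange roles.\<close>
        consider "w = v1 \<or> w = v3" | "w = v2 \<or> w = v4" using wu(1) unfolding v by auto
        then show ?thesis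
        proof cases
          case 1
          then have fw: "f w \<in> {a1, a2, a3}" using im by auto
          have f': "embedding E (insert u (set vs)) A C (f(u := b3))"
            by (rule embedding_extend[OF f(1) conn_vs _ wu(1,3,4)])
               (use sub ab[OF fw, of b3] multipartite(2) v im ab[of a1 b3] ab[of a2 b3] in auto)
          show ?thesis
            by (rule embedding_from_nonadjacent[OF assms(1,2) l(2,1) ll'(1)[symmetric] conn_u sub_u(2) f',
                  of b1 b3 a2])
               (use v im uv nb na multipartite(1,2) in auto)
        next
          case 2
          then have fw: "f w \<in> {b1, b2, b3}" using im by auto
          have f': "embedding E (insert u (set vs)) A C (f(u := a3))"
            by (rule embedding_extend[OF f(1) conn_vs _ wu(1,3,4)])
               (use sub ab[OF _ fw, of a3] multipartite(1) v im ab[of a3 b1] ab[of a3 b2] in auto)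
          show ?thesis
            by (rule embedding_from_nonadjacent[OF assms(1,2) l ll'(1) conn_u sub_u(1) f',
                  of a2 a3 b1])
               (use v im uv nb na multipartite(1,2) in auto)
        qed
      qed
    qed
  qed
qed

theorem embedding_of_non_almost_star:
  assumes "regular_host C A d" "card V = d + 3" "d + 3 \<le> card C"
    and "simple_path V E [a, b, c, e]"
    and "\<And>P. P \<subseteq> V \<Longrightarrow> card P \<le> 2 \<Longrightarrow> \<exists>u v. E u v \<and> (u \<in> P \<longleftrightarrow> v \<in> P)"
  shows "\<exists>f. embedding E V A C f"
proof -
  have sub: "{a, b, c, e} \<subseteq> V" and "distinct [a, b, c, e]"
    using assms(4) by (auto simp: simple_path_def)
  then have "card {a, b, c, e} = 4" by simp
  then have "4 \<le> card V" using card_mono[OF finite_V sub] by simp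
  then have d: "d \<ge> 1" using assms(2) by simp
  show ?thesis
  proof (rule tree_structure[OF assms(4,5)], assumption, assumption)
    fix l l' p q r r'
    assume "leaf E l p" "leaf E l' p" "l \<noteq> l'" "simple_path V E [p, q, r]" "E q r'"
      "r' \<noteq> p" "r' \<noteq> r" "q \<noteq> l" "q \<noteq> l'"
    then show ?thesis by (rule embedding_double_star[OF assms(1-3)])
  next
    fix l p g p' l' u
    assume "leaf E l p" "leaf E l' p'" "simple_path V E [l, p, g, p', l']" "E g u" "u \<noteq> p" "u \<noteq> p'"
    then show ?thesis by (rule embedding_spider[OF assms(1-3) d])
  next
    fix l vs l'
    assume "leaf E l (hd vs)" "leaf E l' (last vs)" "simple_path V E (l # vs @ [l'])" "4 \<le> length vs"
    then show ?thesis by (rule embedding_long[OF assms(1-3)])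
  qed
qed

end

section \<open>Components, parity and disjoint unions\<close>

text \<open>The adjacency is restricted to edges starting in the component, as required by
  \<open>adj_in1\<close>. Connectivity uses that reachability is symmetric: a closed nonempty subset
  contains everything reachable from one of its vertices, hence also \<open>x\<close> and the whole
  component.\<close>

lemma (in adj_graph) component_regular_host:
  assumes "\<And>x. x \<in> V \<Longrightarrow> card (nbrs E x) = d" "x \<in> V"
  shows "regular_host {y. E\<^sup>*\<^sup>* x y} (\<lambda>a b. E\<^sup>*\<^sup>* x a \<and> E a b) d"
proof -
  have sub: "y \<in> V" if "E\<^sup>*\<^sup>* x y" for y
    using that assms(2) adj_in2 by (induction rule: rtranclp_induct) auto
  then have "{y. E\<^sup>*\<^sup>* x y} \<subseteq> V" by blast
  then have "finite {y. E\<^sup>*\<^sup>* x y}" using finite_V finite_subset by blast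
  then interpret C: adj_graph "{y. E\<^sup>*\<^sup>* x y}" "\<lambda>a b. E\<^sup>*\<^sup>* x a \<and> E a b"
    using adj_sym adj_irrefl by unfold_locales (auto intro: rtranclp.rtrancl_into_rtrancl)
  have "nbrs (\<lambda>a b. E\<^sup>*\<^sup>* x a \<and> E a b) y = nbrs E y" if "E\<^sup>*\<^sup>* x y" for y
    using that by (simp add: nbrs_def)
  moreover have "adj_connected (\<lambda>a b. E\<^sup>*\<^sup>* x a \<and> E a b) {y. E\<^sup>*\<^sup>* x y}"
    unfolding adj_connected_def
  proof (intro allI impI)
    fix X assume X: "X \<subseteq> {y. E\<^sup>*\<^sup>* x y}" "X \<noteq> {}" "X \<noteq> {y. E\<^sup>*\<^sup>* x y}"
    show "\<exists>a\<in>X. \<exists>b\<in>{y. E\<^sup>*\<^sup>* x y} - X. E\<^sup>*\<^sup>* x a \<and> E a b"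
    proof (rule ccontr)
      assume no: "\<not> ?thesis"
      have closed: "b \<in> X" if "a \<in> X" "E a b" for a b
        using no that X(1) by (auto dest: rtranclp.rtrancl_into_rtrancl)
      obtain a where a: "a \<in> X" using X(2) by blast
      have "E\<^sup>*\<^sup>* a x" using X(1) a adj_sym by (metis mem_Collect_eq subsetD sympD sympI symp_rtranclp)
      then have "E\<^sup>*\<^sup>* a y" if "E\<^sup>*\<^sup>* x y" for y using that by (rule rtranclp_trans)
      moreover have "y \<in> X" if "E\<^sup>*\<^sup>* a y" for y
        using that a closed by (induction rule: rtranclp_induct) auto
      ultimately show False using X(1,3) by blast
    qed
  qed
  ultimately show ?thesis
    using assms(1) sub by unfold_locales auto
qed

lemma (in adj_graph) dvd_card_if_dvd_components:
  assumes "\<And>x. x \<in> V \<Longrightarrow> k dvd card {y. E\<^sup>*\<^sup>* x y}"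
  shows "k dvd card V"
proof -
  define r where "r = {(x, y). x \<in> V \<and> E\<^sup>*\<^sup>* x y}"
  have sub: "y \<in> V" if "E\<^sup>*\<^sup>* x y" "x \<in> V" for x y
    using that adj_in2 by (induction rule: rtranclp_induct) auto
  have "symp E\<^sup>*\<^sup>*" using adj_sym by (intro symp_rtranclp sympI)
  then have "equiv V r"
    using sub by (auto simp: equiv_def r_def refl_on_def sym_def trans_def dest: sympD)
  moreover have "k dvd card X" if X: "X \<in> V // r" for X
  proof -
    obtain x where "x \<in> V" "X = r `` {x}" using X by (rule quotientE)
    then show ?thesis using assms[of x] by (simp add: r_def)
  qed
  ultimately show ?thesis using equiv_imp_dvd_card finite_V by blast
qed

section \<open>The handshake lemma\<close>

lemma (in adj_graph) sum_degrees:
  "(\<Sum>v\<in>V. card (nbrs E v)) = card {(u, v). E u v}"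
proof -
  have "{(u, v). E u v} = (SIGMA u:V. nbrs E u)" using adj_in1 by auto
  then show ?thesis using finite_V finite_nbrs by simp
qed

text \<open>The linear order selects one orientation of every edge; the other orientations are their
  mirror images.\<close>

lemma even_card_symmetric:
  fixes E :: "'a :: linorder \<Rightarrow> 'a \<Rightarrow> bool"
  assumes "adj_graph V E"
  shows "even (card {(u, v). E u v})"
proof -
  interpret adj_graph V E by fact
  define L where "L = {(u, v). E u v \<and> u < v}"
  have "{(u, v). E u v} \<subseteq> V \<times> V" using adj_in1 adj_in2 by auto
  then have fin: "finite {(u, v). E u v}" using finite_V finite_subset by blast
  have "L \<subseteq> {(u, v). E u v}" unfolding L_def by auto
  then have L: "finite L" using fin finite_subset by blast
  have "{(u, v). E u v} = L \<union> prod.swap ` L"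
  proof (intro equalityI subsetI)
    fix p assume "p \<in> {(u, v). E u v}"
    then obtain u v where p: "p = (u, v)" "E u v" by blast
    then consider "u < v" | "v < u" using adj_neq[OF p(2)] by (cases u v rule: linorder_cases) auto
    then show "p \<in> L \<union> prod.swap ` L"
    proof cases
      case 2
      then have "(v, u) \<in> L" using p adj_sym unfolding L_def by blast
      then show ?thesis unfolding p(1) by (metis UnI2 image_eqI swap_simp)
    qed (use p in \<open>auto simp: L_def\<close>)
  qed (use adj_sym in \<open>auto simp: L_def\<close>)
  moreover have "L \<inter> prod.swap ` L = {}" unfolding L_def by auto
  moreover have "card (prod.swap ` L) = card L" by (simp add: card_image)
  ultimately show ?thesis using L by (simp add: card_Un_disjoint)
qed

lemma even_order_times_degree:
  fixes E :: "'a :: linorder \<Rightarrow> 'a \<Rightarrow> bool"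
  assumes "adj_graph V E" "\<And>x. x \<in> V \<Longrightarrow> card (nbrs E x) = d"
  shows "even (card V * d)"
  using even_card_symmetric[OF assms(1)] assms(2) by (simp flip: adj_graph.sum_degrees[OF assms(1)])

definition regular_on :: "nat set \<Rightarrow> (nat \<Rightarrow> nat \<Rightarrow> bool) \<Rightarrow> nat \<Rightarrow> bool" where
  "regular_on W A d \<longleftrightarrow> adj_graph W A \<and> (\<forall>x\<in>W. card (nbrs A x) = d)"

text \<open>The set of all \<open>d\<close> with this property is the one maximized in
  \<open>regex\<close>; see \<open>regex_eqI\<close>.\<close>

definition free_regular :: "('a \<Rightarrow> 'a \<Rightarrow> bool) \<Rightarrow> 'a set \<Rightarrow> nat \<Rightarrow> nat \<Rightarrow> bool" where
  "free_regular E V d n \<longleftrightarrow>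
     (\<exists>W A. regular_on W A d \<and> card W = n \<and> (\<nexists>f. embedding E V A W f))"

section \<open>Building blocks: complete, cocktail party and balanced complete bipartite
  graphs\<close>

lemma complete_block: "\<exists>W A. regular_on W A d \<and> card W = d + 1"
proof -
  define A where "A = (\<lambda>x y. x \<le> d \<and> y \<le> d \<and> x \<noteq> y)"
  have "nbrs A x = {..d} - {x}" if "x \<le> d" for x using that by (auto simp: A_def)
  then have "card (nbrs A x) = d" if "x \<le> d" for x using that by simp
  moreover have "adj_graph {..d} A" by unfold_locales (auto simp: A_def)
  ultimately have "regular_on {..d} A d" unfolding regular_on_def by simp
  then show ?thesis by (metis Suc_eq_plus1 card_atMost)
qed

text \<open>The complete graph minus the perfect matching of the pairs \<open>{2 k, 2 k + 1}\<close>.\<close>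

lemma cocktail_block:
  assumes "even d"
  shows "\<exists>W A. regular_on W A d \<and> card W = d + 2"
proof -
  define A where "A = (\<lambda>x y :: nat. x < d + 2 \<and> y < d + 2 \<and> x div 2 \<noteq> y div 2)"
  have "card (nbrs A x) = d" if x: "x < d + 2" for x
  proof -
    have pair: "y div 2 = x div 2 \<longleftrightarrow> y = 2 * (x div 2) \<or> y = 2 * (x div 2) + 1" for y by linarith
    have "y \<in> nbrs A x \<longleftrightarrow> y \<in> {..<d + 2} - {2 * (x div 2), 2 * (x div 2) + 1}" for y
      unfolding A_def in_nbrs Diff_iff insert_iff empty_iff lessThan_iff using x pair[of y] by metis
    then have "nbrs A x = {..<d + 2} - {2 * (x div 2), 2 * (x div 2) + 1}" by blast
    moreover have "{2 * (x div 2), 2 * (x div 2) + 1} \<subseteq> {..<d + 2}" using x assms by auto presburger+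
    ultimately show ?thesis by (simp add: card_Diff_subset)
  qed
  moreover have "adj_graph {..<d + 2} A" by unfold_locales (auto simp: A_def)
  ultimately have "regular_on {..<d + 2} A d" unfolding regular_on_def by simp
  then show ?thesis by (metis card_lessThan)
qed

lemma bipartite_block:
  "\<exists>W A c. regular_on W A d \<and> card W = 2 * d \<and> (\<forall>x y. A x y \<longrightarrow> c x \<noteq> (c y :: bool)) \<and>
     (\<forall>b. card {x \<in> W. c x = b} = d)"
proof -
  define c where "c = (\<lambda>x. x < d)"
  define A where "A = (\<lambda>x y :: nat. x < 2 * d \<and> y < 2 * d \<and> c x \<noteq> c y)"
  have lo: "{x \<in> {..<2 * d}. c x} = {..<d}" and hi: "{x \<in> {..<2 * d}. \<not> c x} = {d..<2 * d}"
    by (auto simp: c_def)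
  have parts: "card {x \<in> {..<2 * d}. c x = b} = d" for b using lo hi by (cases b) auto
  have "nbrs A x = {y \<in> {..<2 * d}. c y = (\<not> c x)}" if "x < 2 * d" for x
    using that by (auto simp: A_def)
  then have "card (nbrs A x) = d" if "x < 2 * d" for x using that parts by simp
  moreover have "adj_graph {..<2 * d} A" by unfold_locales (auto simp: A_def)
  ultimately have "regular_on {..<2 * d} A d" unfolding regular_on_def by simp
  moreover have "A x y \<longrightarrow> c x \<noteq> c y" for x y by (simp add: A_def)
  ultimately show ?thesis using parts by (metis card_lessThan)
qed

section \<open>Disjoint unions of hosts and the orders they attain\<close>

lemma free_regular_0: "V \<noteq> {} \<Longrightarrow> free_regular E V d 0"
  unfolding free_regular_def regular_on_def
  by (intro exI[of _ "{}"] exI[of _ "\<lambda>_ _. False"]) (auto simp: embedding_def adj_graph_def)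

text \<open>The disjoint union is formed by shifting the second host beyond the first. A connected
  pattern embedded into it stays on one side.\<close>

lemma free_regular_add:
  assumes conn: "adj_connected E V"
    and "free_regular E V d a" "free_regular E V d b"
  shows "free_regular E V d (a + b)"
proof -
  obtain W A where W: "regular_on W A d" "card W = a" "\<nexists>f. embedding E V A W f"
    using assms(2) unfolding free_regular_def by blast
  obtain W' A' where W': "regular_on W' A' d" "card W' = b" "\<nexists>f. embedding E V A' W' f"
    using assms(3) unfolding free_regular_def by blast
  interpret G: adj_graph W A using W(1) by (simp add: regular_on_def)
  interpret G': adj_graph W' A' using W'(1) by (simp add: regular_on_def)
  obtain N where N: "W \<subseteq> {..<N}" using G.finite_V finite_nat_bounded by blast
  define U where "U = (+) N ` W'"
  define B where "B = (\<lambda>x y. A x y \<or> (N \<le> x \<and> N \<le> y \<and> A' (x - N) (y - N)))"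
  have lt: "x < N" if "x \<in> W" for x using that N by auto
  have U: "x \<in> U \<longleftrightarrow> N \<le> x \<and> x - N \<in> W'" for x unfolding U_def by force
  have nW: "nbrs B x = nbrs A x" if "x \<in> W" for x using lt[OF that] by (auto simp: B_def)
  have nU: "nbrs B x = (+) N ` nbrs A' (x - N)" if "x \<in> U" for x
  proof -
    have "N \<le> x" "x \<notin> W" using that U lt[of x] by auto
    then have x: "N \<le> x" "\<not> A x y" for y using G.adj_in1 by auto
    show ?thesis
    proof (intro equalityI subsetI)
      fix y assume "y \<in> nbrs B x"
      then have "N \<le> y" "A' (x - N) (y - N)" using x by (auto simp: B_def)
      then show "y \<in> (+) N ` nbrs A' (x - N)" by (intro image_eqI[of _ _ "y - N"]) auto
    qed (use x in \<open>auto simp: B_def\<close>)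
  qed
  have "adj_graph (W \<union> U) B"
  proof
    show "finite (W \<union> U)" using G.finite_V G'.finite_V by (simp add: U_def)
    show "u \<in> W \<union> U" if "B u v" for u v using that G.adj_in1 G'.adj_in1 U by (auto simp: B_def)
    show "B v u" if "B u v" for u v using that G.adj_sym G'.adj_sym by (auto simp: B_def)
    show "\<not> B u u" for u using G.adj_irrefl G'.adj_irrefl by (simp add: B_def)
  qed
  moreover have "card (nbrs B x) = d" if "x \<in> W \<union> U" for x
    using that W(1) W'(1) nW nU U by (auto simp: regular_on_def card_image)
  ultimately have "regular_on (W \<union> U) B d" by (simp add: regular_on_def)
  moreover have "card (W \<union> U) = a + b"
  proof -
    have "W \<inter> U = {}" using lt U by force
    then show ?thesis using W(2) W'(2) G.finite_V G'.finite_V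
      by (simp add: card_Un_disjoint U_def card_image)
  qed
  moreover have "\<not> embedding E V B (W \<union> U) f" for f
  proof
    assume f: "embedding E V B (W \<union> U) f"
    \<comment> \<open>The vertices sent to the first host. Connectivity would give an edge leaving a
      nonempty proper \<open>X\<close>, but \<open>B\<close> has no edge between the two
      sides.\<close>
    define X where "X = {v \<in> V. f v \<in> W}"
    consider "X = V" | "X = {}" | "X \<noteq> {}" "X \<noteq> V" by blast
    then show False
    proof cases
      case 1
      have "embedding E V A W f"
        unfolding embedding_def
      proof (intro conjI ballI impI)
        show "inj_on f V" using f by (simp add: embedding_def)
        show "f ` V \<subseteq> W" using 1 unfolding X_def by auto
        fix u v assume uv: "u \<in> V" "v \<in> V" "E u v"
        then have "B (f u) (f v)" using f by (simp add: embedding_def)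
        moreover have "f u \<in> W" using uv(1) 1 unfolding X_def by auto
        ultimately show "A (f u) (f v)" using lt by (force simp: B_def)
      qed
      then show False using W(3) by blast
    next
      case 2
      then have fU: "f v \<in> U" if "v \<in> V" for v
        using f that unfolding X_def embedding_def by auto
      then have fN: "N \<le> f v" "f v - N \<in> W'" "f v \<notin> W" if "v \<in> V" for v
        using U[of "f v"] fU[OF that] lt[of "f v"] by auto
      have "embedding E V A' W' (\<lambda>v. f v - N)"
        unfolding embedding_def
      proof (intro conjI ballI impI)
        show "inj_on (\<lambda>v. f v - N) V"
          using f fN(1) unfolding embedding_def inj_on_def by (metis le_add_diff_inverse)
        show "(\<lambda>v. f v - N) ` V \<subseteq> W'" using fN(2) by auto
        fix u v assume uv: "u \<in> V" "v \<in> V" "E u v"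
        then have "B (f u) (f v)" using f by (simp add: embedding_def)
        then show "A' (f u - N) (f v - N)" using fN(3)[OF uv(1)] G.adj_in1 by (auto simp: B_def)
      qed
      then show False using W'(3) by blast
    next
      case 3
      then obtain u v where uv: "u \<in> X" "v \<in> V" "v \<notin> X" "E u v"
        using conn unfolding adj_connected_def X_def by blast
      then have "B (f u) (f v)" "f u < N" using f lt by (auto simp: embedding_def X_def)
      then have "f v \<in> W" using G.adj_in2 by (auto simp: B_def)
      then show False using uv unfolding X_def by simp
    qed
  qed
  ultimately show ?thesis unfolding free_regular_def by blast
qed

lemma free_regular_mult:
  assumes "adj_connected E V" "V \<noteq> {}" "free_regular E V d a"
  shows "free_regular E V d (k * a)"
proof (induction k)
  case 0
  then show ?case using free_regular_0[OF assms(2)] by simp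
next
  case (Suc k)
  then show ?case using free_regular_add[OF assms(1,3)] by simp
qed

lemma free_regular_combination:
  assumes "adj_connected E V" "V \<noteq> {}" "free_regular E V d a" "free_regular E V d b"
  shows "free_regular E V d (k * a + l * b)"
  using assms by (intro free_regular_add free_regular_mult)

text \<open>Start from \<open>n div m\<close> blocks of size \<open>m\<close> and enlarge
  \<open>n mod m\<close> of them by one; there are enough blocks because
  \<open>n mod m < m \<le> n div m\<close>.\<close>

lemma consecutive_combination:
  fixes m n :: nat
  assumes "m * m \<le> n" "m > 0"
  shows "\<exists>k l. n = k * m + l * (m + 1)"
proof -
  have "n mod m \<le> n div m"
    using assms by (metis less_eq_div_iff_mult_less_eq less_imp_le mod_less_divisor order_trans)
  then obtain k where "n div m = k + n mod m" by (metis le_add_diff_inverse2)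
  then have "n = k * m + n mod m * (m + 1)"
    using div_mult_mod_eq[of n m] by (simp add: algebra_simps)
  then show ?thesis by blast
qed

text \<open>With \<open>d + 1 = 2 * h\<close> and \<open>n = 2 * m\<close>, choose
  \<open>l < h\<close> such that \<open>h\<close> divides \<open>m + l\<close>, say
  \<open>m + l = h * k\<close>. Then \<open>n = 2 * h * k - 2 * l\<close>, which consists of
  \<open>l\<close> blocks of size \<open>2 * d = 4 * h - 2\<close> and \<open>k - 2 * l\<close>
  blocks of size \<open>2 * h\<close>; the bound on \<open>n\<close> ensures
  \<open>2 * l \<le> k\<close>.\<close>

lemma even_combination:
  fixes d n :: nat
  assumes "odd d" "even n" "4 * d * (d + 1) \<le> n"
  shows "\<exists>k l. n = k * (d + 1) + l * (2 * d)"
proof -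
  obtain h where h: "d + 1 = 2 * h" using assms(1) by (metis even_add odd_one evenE)
  obtain m where m: "n = 2 * m" using assms(2) by (metis evenE)
  have "h > 0" using h by simp
  \<comment> \<open>The residue of \<open>- m\<close> modulo \<open>h\<close>; the outer
    \<open>mod\<close> covers the case that \<open>h\<close> divides \<open>m\<close>.\<close>
  define l where "l = (h - m mod h) mod h"
  have "l < h" unfolding l_def using \<open>h > 0\<close> by simp
  have "h dvd m + l"
    unfolding l_def using \<open>h > 0\<close>
    by (metis dvd_eq_mod_eq_0 le_add_diff_inverse less_imp_le mod_add_eq mod_add_right_eq mod_add_left_eq mod_less_divisor mod_self)
  then obtain k where k: "m + l = h * k" by blast
  have "h * (2 * l) \<le> h * (2 * h)" using \<open>l < h\<close> by simp
  also have "\<dots> \<le> m" 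
  proof -
    have "4 * d * (2 * h) \<le> 2 * m" using assms(3) unfolding m h .
    then have "2 * d * (2 * h) \<le> m" by simp
    moreover have "h \<le> 2 * d" using h \<open>h > 0\<close> by linarith
    ultimately show ?thesis by (meson le_trans mult_le_mono1 mult.commute) 
  qed
  finally have "h * (2 * l) \<le> h * k" using k by linarith
  then have "2 * l \<le> k" using \<open>h > 0\<close> by simp
  then obtain j where j: "k = 2 * l + j" using le_Suc_ex by blast
  have "m + l = 2 * (h * l) + h * j" using k j by (simp add: algebra_simps)
  then have "2 * m + 2 * l = l * (2 * (2 * h)) + j * (2 * h)" by (simp add: algebra_simps)
  then have "n = j * (d + 1) + l * (2 * d)" unfolding m h[symmetric] by (simp add: algebra_simps)
  then show ?thesis by blast
qed

section \<open>Degrees of tree-free regular graphs\<close>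

abbreviation adj :: "'a pair_pre_digraph \<Rightarrow> 'a \<Rightarrow> 'a \<Rightarrow> bool" where
  "adj G \<equiv> (\<lambda>u v. (u, v) \<in> parcs G)"

lemma pair_graph_iff_adj_graph: "pair_graph G \<longleftrightarrow> adj_graph (pverts G) (adj G)"
proof
  assume "pair_graph G"
  then interpret pair_graph G .
  show "adj_graph (pverts G) (adj G)"
    using pair_finite_verts in_arcsD1 arcs_symmetric no_loops' by unfold_locales blast+
next
  assume "adj_graph (pverts G) (adj G)"
  then interpret adj_graph "pverts G" "adj G" .
  have "parcs G \<subseteq> pverts G \<times> pverts G" using adj_in1 adj_in2 by auto
  then have "finite (parcs G)" using finite_V finite_subset by blast
  then show "pair_graph G"
    using finite_V adj_in1 adj_in2 adj_sym adj_irrefl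
    by unfold_locales (auto simp: symmetric_def intro: symI)
qed

lemma out_degree_adj: "out_degree (with_proj G) v = card (nbrs (adj G) v)"
proof -
  have "out_arcs (with_proj G) v = Pair v ` nbrs (adj G) v" by (auto simp: out_arcs_def)
  then show ?thesis by (simp add: out_degree_def card_image inj_on_def)
qed

lemma contains_copy_iff_embedding:
  assumes "pair_graph F" "pair_graph G"
  shows "contains_copy F G \<longleftrightarrow> (\<exists>f. embedding (adj F) (pverts F) (adj G) (pverts G) f)"
proof
  interpret F: pair_graph F by fact
  assume "contains_copy F G"
  then obtain H h where H: "subgraph (with_proj H) (with_proj G)"
    and h: "pre_digraph.digraph_isomorphism (with_proj F) h" "with_proj H = app_iso h (with_proj F)"
    unfolding contains_copy_def digraph_iso_def by blast
  have eq: "pverts H = iso_verts h ` pverts F" "parcs H = iso_arcs h ` parcs F"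
    "iso_tail h = fst" "iso_head h = snd"
    using h(2) unfolding with_proj_def app_iso_def by auto
  have sub: "pverts H \<subseteq> pverts G" "parcs H \<subseteq> parcs G" using H by (auto simp: subgraph_def)
  have "(iso_verts h u, iso_verts h v) \<in> parcs G" if "(u, v) \<in> parcs F" for u v
  proof -
    have "iso_verts h u = fst (iso_arcs h (u, v))" "iso_verts h v = snd (iso_arcs h (u, v))"
      using h(1) that unfolding F.digraph_isomorphism_def eq(3,4) by force+
    then have "(iso_verts h u, iso_verts h v) \<in> parcs H" unfolding eq(2) using that by force
    then show ?thesis using sub by blast
  qed
  moreover have "inj_on (iso_verts h) (pverts F)"
    using h(1) unfolding F.digraph_isomorphism_def by blast
  ultimately have "embedding (adj F) (pverts F) (adj G) (pverts G) (iso_verts h)"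
    using sub(1) eq(1) unfolding embedding_def by blast
  then show "\<exists>f. embedding (adj F) (pverts F) (adj G) (pverts G) f" by blast
next
  interpret F: pair_graph F by fact
  interpret G: pair_graph G by fact
  assume "\<exists>f. embedding (adj F) (pverts F) (adj G) (pverts G) f"
  then obtain f where emb: "embedding (adj F) (pverts F) (adj G) (pverts G) f" ..
  have f: "inj_on f (pverts F)" "f ` pverts F \<subseteq> pverts G"
    using emb by (simp_all add: embedding_def)
  have fE: "(f u, f v) \<in> parcs G" if "(u, v) \<in> parcs F" for u v
    using emb that F.in_arcsD1[OF that] F.in_arcsD2[OF that] by (simp add: embedding_def)
  define H where "H = \<lparr>pverts = f ` pverts F, parcs = map_prod f f ` parcs F\<rparr>"
  define h where "h = \<lparr>iso_verts = f, iso_arcs = map_prod f f, iso_head = snd, iso_tail = fst\<rparr>"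
  have "parcs F \<subseteq> pverts F \<times> pverts F" using F.in_arcsD1 F.in_arcsD2 by auto
  then have "inj_on (map_prod f f) (parcs F)"
    using map_prod_inj_on[OF f(1) f(1)] inj_on_subset by blast
  then have "pre_digraph.digraph_isomorphism (with_proj F) h"
    unfolding F.digraph_isomorphism_def h_def using f(1) F.wf_digraph by (auto simp: wf_digraph_wp_iff)
  moreover have "with_proj H = app_iso h (with_proj F)"
    unfolding with_proj_def app_iso_def H_def h_def by simp
  moreover have "subgraph (with_proj H) (with_proj G)"
  proof -
    have "pair_wf_digraph H"
      by unfold_locales (use F.in_arcsD1 F.in_arcsD2 in \<open>force simp: H_def\<close>)+
    moreover have "pair_wf_digraph G" by unfold_locales
    ultimately show ?thesis
      using f(2) fE unfolding subgraph_def by (auto simp: H_def wf_digraph_wp_iff)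
  qed
  ultimately show "contains_copy F G" unfolding contains_copy_def digraph_iso_def by blast
qed

text \<open>The third premise bounds the set of admissible degrees, so that it is finite and its
  \<open>Max\<close> is the attained bound \<open>D\<close>.\<close>

lemma regex_eqI:
  assumes "pair_graph T" "free_regular (adj T) (pverts T) D n"
    and "\<And>d. free_regular (adj T) (pverts T) d n \<Longrightarrow> d \<le> D"
  shows "regex n T = D"
proof -
  have "(\<exists>G :: nat pair_pre_digraph. regular_graph d G \<and> card (pverts G) = n \<and> free_of T G) \<longleftrightarrow>
      free_regular (adj T) (pverts T) d n" for d
  proof
    assume "\<exists>G :: nat pair_pre_digraph. regular_graph d G \<and> card (pverts G) = n \<and> free_of T G"
    then obtain G :: "nat pair_pre_digraph" where
      G: "regular_graph d G" "card (pverts G) = n" "free_of T G" by blast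
    then have "regular_on (pverts G) (adj G) d"
      by (simp add: regular_graph_def regular_on_def pair_graph_iff_adj_graph out_degree_adj)
    moreover have "\<nexists>f. embedding (adj T) (pverts T) (adj G) (pverts G) f"
      using G assms(1) contains_copy_iff_embedding unfolding free_of_def regular_graph_def by blast
    ultimately show "free_regular (adj T) (pverts T) d n" using G(2) unfolding free_regular_def by blast
  next
    assume "free_regular (adj T) (pverts T) d n"
    then obtain W A where W: "regular_on W A d" "card W = n" "\<nexists>f. embedding (adj T) (pverts T) A W f"
      unfolding free_regular_def by blast
    define G where "G = \<lparr>pverts = W, parcs = {(u, v). A u v}\<rparr>"
    have G: "pverts G = W" "adj G = A" by (auto simp: G_def)
    have "regular_graph d G" unfolding regular_graph_def pair_graph_iff_adj_graph out_degree_adj G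
      using W(1) by (simp add: regular_on_def)
    moreover from this have "free_of T G"
      using W(3) contains_copy_iff_embedding[OF assms(1), of G]
      unfolding free_of_def regular_graph_def G by blast
    ultimately show "\<exists>G :: nat pair_pre_digraph. regular_graph d G \<and> card (pverts G) = n \<and> free_of T G"
      using W(2) G(1) by blast
  qed
  then have "regex n T = Max {d. free_regular (adj T) (pverts T) d n}" unfolding regex_def by simp
  also have "\<dots> = D"
  proof (rule Max_eqI)
    have "{d. free_regular (adj T) (pverts T) d n} \<subseteq> {..D}" using assms(3) by auto
    then show "finite {d. free_regular (adj T) (pverts T) d n}" using finite_subset by blast
  qed (use assms(2,3) in auto)
  finally show ?thesis .
qed

lemma awalk_of_path:
  assumes "simple_path (pverts G) (adj G) xs"
  shows "\<exists>p. pre_digraph.awalk (with_proj G) (hd xs) p (last xs) \<and> pawalk_verts (hd xs) p = xs \<and>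
    length xs = Suc (length p)"
  using assms
proof (induction xs)
  case (Cons x xs)
  interpret pair_pre_digraph G .
  show ?case
  proof (cases xs)
    case Nil
    then show ?thesis using Cons.prems by (intro exI[of _ "[]"]) (auto simp: simple_path_def awalk_def)
  next
    case (Cons y ys)
    then have xs: "simple_path (pverts G) (adj G) xs" "(x, y) \<in> parcs G" "x \<in> pverts G"
      using Cons.prems by (auto simp: simple_path_def)
    then obtain p where p: "awalk (hd xs) p (last xs)" "pawalk_verts (hd xs) p = xs" "length xs = Suc (length p)"
      using Cons.IH by blast
    then show ?thesis
      using xs(2,3) Cons by (intro exI[of _ "(x, y) # p"]) (auto simp: awalk_def)
  qed
qed (simp add: simple_path_def)

lemma undirected_tree_adj_tree:
  assumes "undirected_tree T"
  shows "adj_tree (pverts T) (adj T)"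
proof -
  interpret T: pair_graph T using assms unfolding undirected_tree_def by blast
  interpret adj_graph "pverts T" "adj T" using T.pair_graph pair_graph_iff_adj_graph by blast
  have "(\<Union>e\<in>parcs T. {e, (snd e, fst e)}) = parcs T" using T.arcs_symmetric by auto
  \<comment> \<open>Since \<open>T\<close> is already symmetric, connectedness of \<open>T\<close>
    reduces to reachability in \<open>T\<close> itself.\<close>
  then have sc: "mk_symmetric (with_proj T) = T" by (simp add: mk_symmetric_def)
  have "adj_connected (adj T) (pverts T)"
    unfolding adj_connected_def
  proof (intro allI impI)
    fix X assume X: "X \<subseteq> pverts T" "X \<noteq> {}" "X \<noteq> pverts T"
    then obtain a b where ab: "a \<in> X" "b \<in> pverts T" "b \<notin> X" by blast
    have "(a, b) \<in> rtrancl_on (pverts T) (parcs T)"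
      using assms ab X(1)
      unfolding undirected_tree_def connected_def sc strongly_connected_def reachable_def by auto
    then show "\<exists>x\<in>X. \<exists>y\<in>pverts T - X. (x, y) \<in> parcs T"
      using ab(1,3)
    proof (induction rule: rtrancl_on_induct)
      case (step x y)
      then show ?case by (metis DiffI)
    qed simp
  qed
  moreover have "\<not> adj T (last xs) (hd xs)"
    if xs: "simple_path (pverts T) (adj T) xs" "length xs \<ge> 3" for xs
  proof
    assume e: "adj T (last xs) (hd xs)"
    obtain p where p: "T.awalk (hd xs) p (last xs)" "pawalk_verts (hd xs) p = xs" "length xs = Suc (length p)"
      using awalk_of_path[OF xs(1)] by blast
    \<comment> \<open>The closing edge is put in front, so the tail of the vertex list is exactly
      \<open>xs\<close> and is distinct.\<close>
    define q where "q = (last xs, hd xs) # p"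
    have "T.awalk (last xs) q (last xs)"
      using p(1) e adj_in1 by (auto simp: q_def T.awalk_def)
    moreover have "distinct (tl (pawalk_verts (last xs) q))"
      using p(2) xs(1) by (simp add: q_def simple_path_def)
    ultimately have "T.cycle q" unfolding T.cycle_def by (auto simp: q_def)
    moreover have "length q \<ge> 3" using p(3) xs(2) by (simp add: q_def)
    ultimately show False using assms unfolding undirected_tree_def by blast
  qed
  ultimately show ?thesis by unfold_locales
qed

lemma star_graph_iff_center:
  assumes "pair_graph T"
  shows "star_graph T \<longleftrightarrow> (\<exists>c\<in>pverts T. \<forall>u v. adj T u v \<longleftrightarrow>
    u \<in> pverts T \<and> v \<in> pverts T \<and> u \<noteq> v \<and> (u = c \<or> v = c))"
proof
  assume "star_graph T"
  then obtain U V where UV: "pverts T = U \<union> V" "U \<inter> V = {}" "card U = 1" "parcs T = U \<times> V \<union> V \<times> U"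
    unfolding star_graph_def complete_bipartite_digraph_pair_def by blast
  then obtain c where "U = {c}" using card_1_singletonE by blast
  then show "\<exists>c\<in>pverts T. \<forall>u v. adj T u v \<longleftrightarrow>
    u \<in> pverts T \<and> v \<in> pverts T \<and> u \<noteq> v \<and> (u = c \<or> v = c)"
    using UV by (intro bexI[of _ c]) auto
next
  interpret pair_graph T by fact
  assume "\<exists>c\<in>pverts T. \<forall>u v. adj T u v \<longleftrightarrow>
    u \<in> pverts T \<and> v \<in> pverts T \<and> u \<noteq> v \<and> (u = c \<or> v = c)"
  then obtain c where c: "c \<in> pverts T" "\<And>u v. adj T u v \<longleftrightarrow>
    u \<in> pverts T \<and> v \<in> pverts T \<and> u \<noteq> v \<and> (u = c \<or> v = c)" by blast
  show "star_graph T"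
    unfolding star_graph_def complete_bipartite_digraph_pair_def
  proof (intro conjI exI)
    show "parcs T = {c} \<times> (pverts T - {c}) \<union> (pverts T - {c}) \<times> {c}" using c by auto
    show "card (pverts T - {c}) = card (pverts T) - 1" using c(1) by simp
    show "pverts T = {c} \<union> (pverts T - {c})" using c(1) by blast
  qed (use pair_finite_verts in auto)
qed

lemma almost_star_iff:
  assumes "undirected_tree T"
  shows "almost_star T \<longleftrightarrow> (\<exists>P \<subseteq> pverts T. card P \<le> 2 \<and> (\<forall>u v. adj T u v \<longrightarrow> (u \<in> P) \<noteq> (v \<in> P)))"
proof
  interpret adj_tree "pverts T" "adj T" using undirected_tree_adj_tree[OF assms] .
  assume "almost_star T"
  then obtain c b where c: "proper_2_coloring T c" "card {v \<in> pverts T. c v = b} \<le> 2"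
    unfolding almost_star_def by blast
  have "(u \<in> {v \<in> pverts T. c v = b}) \<noteq> (v \<in> {v \<in> pverts T. c v = b})" if "adj T u v" for u v
  proof -
    have "c u \<noteq> c v" using c(1) that unfolding proper_2_coloring_def by blast
    then show ?thesis using adj_in1[OF that] adj_in2[OF that] by auto
  qed
  then show "\<exists>P \<subseteq> pverts T. card P \<le> 2 \<and> (\<forall>u v. adj T u v \<longrightarrow> (u \<in> P) \<noteq> (v \<in> P))"
    using c(2) by (intro exI[of _ "{v \<in> pverts T. c v = b}"]) blast
next
  assume "\<exists>P \<subseteq> pverts T. card P \<le> 2 \<and> (\<forall>u v. adj T u v \<longrightarrow> (u \<in> P) \<noteq> (v \<in> P))"
  then obtain P where P: "P \<subseteq> pverts T" "card P \<le> 2" "\<And>u v. adj T u v \<Longrightarrow> (u \<in> P) \<noteq> (v \<in> P)"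
    by blast
  have "{v \<in> pverts T. (v \<in> P) = True} = P" using P(1) by auto
  moreover have "proper_2_coloring T (\<lambda>v. v \<in> P)" using P(3) unfolding proper_2_coloring_def by auto
  ultimately show "almost_star T"
    unfolding almost_star_def using assms P(2)
    by (intro conjI exI[of _ "\<lambda>v. v \<in> P"] exI[of _ True]) simp_all
qed

section \<open>Restrictions on the degrees of tree-free regular hosts\<close>

context adj_tree
begin

lemma regular_on_component_host:
  assumes "regular_on W A d" "x \<in> W"
  obtains C B where "C = {y. A\<^sup>*\<^sup>* x y}" "regular_host C B d" "\<And>f. embedding E V B C f \<Longrightarrow> embedding E V A W f"
    "d + 1 \<le> card C"
proof -
  interpret W: adj_graph W A using assms(1) by (simp add: regular_on_def)
  define C where "C = {y. A\<^sup>*\<^sup>* x y}"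
  define B where "B = (\<lambda>a b. A\<^sup>*\<^sup>* x a \<and> A a b)"
  interpret H: regular_host C B d
    unfolding B_def C_def using assms by (intro W.component_regular_host) (auto simp: regular_on_def)
  have sub: "C \<subseteq> W"
  proof
    fix y assume "y \<in> C"
    then have "A\<^sup>*\<^sup>* x y" by (simp add: C_def)
    then show "y \<in> W" using assms(2) W.adj_in2 by (induction rule: rtranclp_induct) auto
  qed
  have x: "x \<in> C" by (simp add: C_def)
  have "insert x (nbrs B x) \<subseteq> C" using x H.nbrs_subset by blast
  then have "card (insert x (nbrs B x)) \<le> card C" using H.finite_V card_mono by blast
  then have "d + 1 \<le> card C" using H.deg[OF x] H.finite_nbrs H.adj_irrefl by simp
  moreover have "embedding E V A W f" if "embedding E V B C f" for f
    by (rule embedding_adj_mono[OF that _ sub]) (simp add: B_def)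
  ultimately show thesis using that[of C B] H.regular_host_axioms by (simp add: C_def)
qed

lemma free_regular_degree_bound:
  assumes "free_regular E V d n" "n > 0" "V \<noteq> {}"
  shows "d + 2 \<le> card V"
proof (rule ccontr)
  assume small: "\<not> d + 2 \<le> card V"
  obtain W A where W: "regular_on W A d" "card W = n" "\<nexists>f. embedding E V A W f"
    using assms(1) unfolding free_regular_def by blast
  interpret W: adj_graph W A using W(1) by (simp add: regular_on_def)
  obtain x v where x: "x \<in> W" and v: "v \<in> V" using W(2) assms(2,3) by fastforce
  have "embedding E {v} A W (\<lambda>_. x)" using x adj_irrefl by (simp add: embedding_def)
  then have "\<exists>g. embedding E V A W g \<and> (\<forall>u\<in>{v}. g u = x)"
    using embedding_greedy[OF W.adj_graph_axioms conn subset_refl _ _ adj_connected_singleton, of v]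
      v small W(1) unfolding regular_on_def by auto
  then show False using W(3) by blast
qed

text \<open>This is degree \<open>t - 2\<close> for a non-star: a component with more than
  \<open>d + 1\<close> vertices would contain the tree, so all components are complete.\<close>

lemma free_regular_dvd:
  assumes "free_regular E V d n" "card V = d + 2" "simple_path V E [a, b, c, e]"
  shows "d + 1 dvd n"
proof -
  obtain W A where W: "regular_on W A d" "card W = n" "\<nexists>f. embedding E V A W f"
    using assms(1) unfolding free_regular_def by blast
  interpret W: adj_graph W A using W(1) by (simp add: regular_on_def)
  have "d + 1 dvd card {y. A\<^sup>*\<^sup>* x y}" if x: "x \<in> W" for x
  proof -
    obtain C B where C: "C = {y. A\<^sup>*\<^sup>* x y}" "regular_host C B d"
      "\<And>f. embedding E V B C f \<Longrightarrow> embedding E V A W f" "d + 1 \<le> card C"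
      using regular_on_component_host[OF W(1) x] by blast
    then have "\<not> d + 2 \<le> card C"
      using W(3) embedding_of_path4_tree[OF C(2) assms(2) _ assms(3)] by blast
    then have "card C = d + 1" using C(4) by linarith
    then show ?thesis using C(1) by simp
  qed
  then show ?thesis using W.dvd_card_if_dvd_components W(2) by blast
qed

text \<open>This is degree \<open>t - 3\<close>. A component has at most \<open>d + 2\<close>
  vertices by \<open>embedding_of_non_almost_star\<close>, and \<open>d + 2\<close> is impossible
  because a graph of odd degree has even order.\<close>

lemma free_regular_dvd_odd:
  assumes "free_regular E V d n" "card V = d + 3" "simple_path V E [a, b, c, e]" "odd d"
    and "\<And>P. P \<subseteq> V \<Longrightarrow> card P \<le> 2 \<Longrightarrow> \<exists>u v. E u v \<and> (u \<in> P \<longleftrightarrow> v \<in> P)"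
  shows "d + 1 dvd n"
proof -
  obtain W A where W: "regular_on W A d" "card W = n" "\<nexists>f. embedding E V A W f"
    using assms(1) unfolding free_regular_def by blast
  interpret W: adj_graph W A using W(1) by (simp add: regular_on_def)
  have "d + 1 dvd card {y. A\<^sup>*\<^sup>* x y}" if x: "x \<in> W" for x
  proof -
    obtain C B where C: "C = {y. A\<^sup>*\<^sup>* x y}" "regular_host C B d"
      "\<And>f. embedding E V B C f \<Longrightarrow> embedding E V A W f" "d + 1 \<le> card C"
      using regular_on_component_host[OF W(1) x] by blast
    interpret H: regular_host C B d by fact
    have "\<not> d + 3 \<le> card C"
      using C(3) W(3) embedding_of_non_almost_star[OF C(2) assms(2) _ assms(3,5)] by blast
    moreover have "even (card C * d)"
      using even_order_times_degree[OF H.adj_graph_axioms H.deg] .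
    then have "card C \<noteq> d + 2" using assms(4) by auto
    ultimately have "card C = d + 1" using C(4) by linarith
    then show ?thesis using C(1) by simp
  qed
  then show ?thesis using W.dvd_card_if_dvd_components W(2) by blast
qed

section \<open>Constructions of tree-free regular hosts\<close>

lemma free_regular_small:
  assumes "\<exists>W A. regular_on W A d \<and> card W = m" "m < card V"
  shows "free_regular E V d m"
proof -
  obtain W A where W: "regular_on W A d" "card W = m" using assms(1) by blast
  then have "finite W" by (simp add: regular_on_def adj_graph_def)
  then have "\<nexists>f. embedding E V A W f" using embedding_card W(2) assms(2) by (metis leD)
  then show ?thesis using W unfolding free_regular_def by blast
qed

text \<open>The image of the center would need \<open>card V - 1\<close> neighbors, more than
  \<open>d\<close>.\<close>

lemma free_regular_star:
  assumes "\<exists>W A. regular_on W A d \<and> card W = m" "d + 2 \<le> card V"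
    and c: "c \<in> V" "\<And>v. v \<in> V \<Longrightarrow> v \<noteq> c \<Longrightarrow> E c v"
  shows "free_regular E V d m"
proof -
  obtain W A where W: "regular_on W A d" "card W = m" using assms(1) by blast
  interpret W: adj_graph W A using W(1) by (simp add: regular_on_def)
  have "\<not> embedding E V A W f" for f
  proof
    assume f: "embedding E V A W f"
    have "A (f c) (f v)" if "v \<in> V - {c}" for v using f c that unfolding embedding_def by blast
    then have "f ` (V - {c}) \<subseteq> nbrs A (f c)" unfolding nbrs_def by blast
    moreover have "inj_on f (V - {c})" using f unfolding embedding_def by (meson Diff_subset inj_on_subset)
    ultimately have "card (V - {c}) \<le> card (nbrs A (f c))" using W.finite_nbrs card_inj_on_le by blast
    moreover have "card (nbrs A (f c)) = d" using f c(1) W(1) unfolding embedding_def regular_on_def by auto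
    ultimately show False using assms(2) c(1) by simp
  qed
  then show ?thesis using W unfolding free_regular_def by blast
qed

text \<open>
  A connected bipartite graph sits in a bipartite host with its color classes on the two sides.
\<close>

lemma free_regular_bipartite:
  assumes "card V = d + 3" "P \<subseteq> V" "card P \<le> 2" and P: "\<And>u v. E u v \<Longrightarrow> (u \<in> P) \<noteq> (v \<in> P)"
  shows "free_regular E V d (2 * d)"
proof -
  obtain W A c where W: "regular_on W A d" "card W = 2 * d"
    and c: "\<And>x y. A x y \<Longrightarrow> c x \<noteq> (c y :: bool)" "\<And>b. card {x \<in> W. c x = b} = d"
    using bipartite_block[of d] by blast
  interpret W: adj_graph W A using W(1) by (simp add: regular_on_def)
  have "\<not> embedding E V A W f" for f
  proof
    assume f: "embedding E V A W f"
    obtain v0 where v0: "v0 \<in> V" using assms(1) by fastforce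
    \<comment> \<open>\<open>k\<close> records which color class of the tree lies on which side of
      the host; by connectivity it is the same for all vertices.\<close>
    define k where "k = (c (f v0) = (v0 \<in> P))"
    have "{v \<in> V. (c (f v) = (v \<in> P)) = k} = V"
    proof (rule adj_connected_closed[OF conn])
      show "{v \<in> V. (c (f v) = (v \<in> P)) = k} \<noteq> {}" using v0 unfolding k_def by blast
      fix x y assume x: "x \<in> {v \<in> V. (c (f v) = (v \<in> P)) = k}" and y: "y \<in> V" and e: "E x y"
      have "A (f x) (f y)" using f x y e unfolding embedding_def by blast
      then have "c (f x) \<noteq> c (f y)" using c(1) by blast
      then show "y \<in> {v \<in> V. (c (f v) = (v \<in> P)) = k}" using P[OF e] x y by auto
    qed blast
    then have "f ` (V - P) \<subseteq> {x \<in> W. c x = (\<not> k)}" using f unfolding embedding_def by auto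
    moreover have "inj_on f (V - P)" using f unfolding embedding_def by (meson Diff_subset inj_on_subset)
    ultimately have "card (V - P) \<le> d"
      using card_inj_on_le[of f "V - P" "{x \<in> W. c x = (\<not> k)}"] W.finite_V c(2) by simp
    \<comment> \<open>The large color class has at least \<open>d + 1\<close> vertices, but a side
      of the host has only \<open>d\<close>.\<close>
    moreover have "card (V - P) = d + 3 - card P"
      using assms(1,2) finite_V finite_subset by (metis card_Diff_subset)
    ultimately show False using assms(3) by linarith
  qed
  then show ?thesis using W unfolding free_regular_def by blast
qed

lemma free_regular_even_degree:
  assumes "free_regular E V d (d + 1)" "free_regular E V d (d + 2)" "V \<noteq> {}" "(d + 1) * (d + 1) \<le> n"
  shows "free_regular E V d n"
proof -
  obtain k l where "n = k * (d + 1) + l * (d + 1 + 1)"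
    using consecutive_combination[OF assms(4)] by auto
  then show ?thesis using free_regular_combination[OF conn assms(3,1), of "d + 1 + 1" k l] assms(2) by simp
qed

lemma free_regular_odd_degree:
  assumes "free_regular E V d (d + 1)" "free_regular E V d (2 * d)" "V \<noteq> {}" "odd d" "even n"
    "4 * d * (d + 1) \<le> n"
  shows "free_regular E V d n"
proof -
  obtain k l where "n = k * (d + 1) + l * (2 * d)" using even_combination[OF assms(4-6)] by blast
  then show ?thesis using free_regular_combination[OF conn assms(3,1,2)] by simp
qed

lemma free_regular_dvd_order:
  assumes "free_regular E V d (d + 1)" "V \<noteq> {}" "d + 1 dvd n"
  shows "free_regular E V d n"
proof -
  obtain k where "n = k * (d + 1)" using assms(3) by (metis dvd_div_mult_self)
  then show ?thesis using free_regular_mult[OF conn assms(2,1)] by simp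
qed

end

lemma free_regular_even:
  assumes "free_regular E V d n"
  shows "even (n * d)"
  using assms even_order_times_degree unfolding free_regular_def regular_on_def by blast

section \<open>The value of \<open>regex\<close> for all large \<open>n\<close>\<close>

theorem theorem1p3:
  fixes T :: "'a pair_pre_digraph" and t :: nat
  assumes "undirected_tree T"
    and "card (pverts T) = t"
    and "t \<ge> 2"
  shows "\<exists>n0 :: nat. \<forall>n :: nat. n > n0 \<longrightarrow>
    (let C1 = (t - 1 dvd n \<or> (star_graph T \<and> (even t \<or> even n)));
         C2 = (odd t \<or> t - 2 dvd n \<or> star_graph T \<or> (almost_star T \<and> even n))
     in (C1 \<longrightarrow> int (regex n T) = int t - 2) \<and>
        (\<not> C1 \<and> C2 \<longrightarrow> int (regex n T) = int t - 3) \<and>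
        (\<not> C1 \<and> \<not> C2 \<longrightarrow> int (regex n T) = int t - 4))"
proof (intro exI[of _ "4 * t * t"] allI impI)
  fix n assume n: "4 * t * t < n"
  interpret adj_tree "pverts T" "adj T" using undirected_tree_adj_tree[OF assms(1)] .
  have T: "pair_graph T" using assms(1) by (simp add: undirected_tree_def)
  have ne: "pverts T \<noteq> {}" using assms(2,3) by auto
  let ?free = "\<lambda>d n. free_regular (adj T) (pverts T) d n"
  have n0: "n > 0" using n by simp
  have le: "d + 2 \<le> t" if "?free d n" for d
    using free_regular_degree_bound[OF that n0 ne] assms(2) by simp
  have small: "?free d (d + 1)" if "d + 2 \<le> t" for d
    using free_regular_small[OF complete_block[of d]] that assms(2) by simp
  \<comment> \<open>The threshold \<open>4 * t * t\<close> covers the bounds of both numerical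
    combinations for every degree in question.\<close>
  have sq: "(d + 1) * (d + 1) \<le> n" "4 * d * (d + 1) \<le> n" if "d + 2 \<le> t" for d
  proof -
    have "(d + 1) * (d + 1) \<le> t * t" "d * (d + 1) \<le> t * t" using that by (intro mult_le_mono; simp)+
    then show "(d + 1) * (d + 1) \<le> n" "4 * d * (d + 1) \<le> n" using n by auto
  qed
  \<comment> \<open>The complete graph on \<open>d + 1\<close> and the cocktail party graph on
    \<open>d + 2\<close> vertices are both smaller than the tree.\<close>
  have small_even: "?free d n" if "even d" "d + 3 \<le> t" for d
    using free_regular_even_degree[OF small free_regular_small[OF cocktail_block] ne sq(1)] that assms(2)
    by simp
  have no_star_path: "\<exists>a b c e. simple_path (pverts T) (adj T) [a, b, c, e]" if "\<not> star_graph T"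
    using star_or_path4 that assms(2,3) unfolding star_graph_iff_center[OF T] by blast
  \<comment> \<open>Degree \<open>t - 2\<close> fails outside the first case: for a star both
    \<open>t\<close> and \<open>n\<close> would be odd, against the handshake lemma, and for a
    non-star \<open>t - 1\<close> would divide \<open>n\<close>.\<close>
  have not_t2: "d + 2 \<noteq> t" if "?free d n" "\<not> (t - 1 dvd n)" "\<not> (star_graph T \<and> (even t \<or> even n))" for d
  proof
    assume d: "d + 2 = t"
    show False
    proof (cases "star_graph T")
      case True
      then show False using free_regular_even[OF that(1)] that(3) d by auto
    next
      case False
      then show False using no_star_path free_regular_dvd[OF that(1)] that(2) d assms(2) by auto
    qed
  qed
  have C1: "regex n T = t - 2" if "t - 1 dvd n \<or> (star_graph T \<and> (even t \<or> even n))"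
  proof (rule regex_eqI[OF T])
    show "?free (t - 2) n"
    proof (cases "t - 1 dvd n")
      case True
      have e: "t - 2 + 1 = t - 1" "t - 2 + 2 \<le> t" using assms(3) by auto
      show ?thesis using free_regular_dvd_order[OF small[OF e(2)] ne] True unfolding e(1) by blast
    next
      case False
      then have star: "star_graph T" and parity: "even t \<or> even n" using that by auto
      obtain c where c: "c \<in> pverts T" "\<And>v. v \<in> pverts T \<Longrightarrow> v \<noteq> c \<Longrightarrow> adj T c v"
        using star unfolding star_graph_iff_center[OF T] by blast
      have d: "t - 2 + 2 \<le> card (pverts T)" "t - 2 + 2 \<le> t" using assms(2,3) by auto
      \<comment> \<open>Every regular graph of this degree avoids the star, so any block may be used
        whatever its order.\<close>
      note blocks = free_regular_star[OF _ d(1) c]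
      show ?thesis
      proof (cases "even t")
        case True
        then have "even (t - 2)" by simp
        then show ?thesis
          using free_regular_even_degree[OF small[OF d(2)] blocks[OF cocktail_block] ne sq(1)[OF d(2)]] by blast
      next
        case False
        then have "odd (t - 2)" using assms(3) by simp
        moreover have "?free (t - 2) (2 * (t - 2))" using bipartite_block by (intro blocks) blast
        ultimately show ?thesis
          using free_regular_odd_degree[OF small[OF d(2)] _ ne _ _ sq(2)[OF d(2)]] False parity by blast
      qed
    qed
  qed (use le in force)
  have C2: "regex n T = t - 3" "t \<ge> 3"
    if nC1: "\<not> (t - 1 dvd n)" "\<not> (star_graph T \<and> (even t \<or> even n))"
      and C2: "odd t \<or> t - 2 dvd n \<or> star_graph T \<or> (almost_star T \<and> even n)"
  proof -
    \<comment> \<open>For \<open>t = 2\<close> the divisor \<open>t - 1\<close> is 1, which puts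
      every \<open>n\<close> into the first case.\<close>
    show t3: "t \<ge> 3" using nC1(1) assms(3) by (cases "t = 2") auto
    show "regex n T = t - 3"
    proof (rule regex_eqI[OF T])
      show "d \<le> t - 3" if "?free d n" for d using le[OF that] not_t2[OF that nC1] by linarith
      show "?free (t - 3) n"
      proof (cases "odd t")
        case True
        then show ?thesis using small_even[of "t - 3"] t3 by simp
      next
        case False
        have d1: "?free (t - 3) (t - 3 + 1)" using small[of "t - 3"] t3 by simp
        show ?thesis
        proof (cases "t - 2 dvd n")
          case True
          then show ?thesis using free_regular_dvd_order[OF d1 ne] t3 by (simp add: numeral_eq_Suc Suc_diff_Suc)
        next
          case no_dvd: False
          \<comment> \<open>For even \<open>t\<close> a star belongs to the first case, so only this
            alternative is left.\<close>
          then have "almost_star T" "even n" using False C2 nC1(2) by auto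
          then obtain P where P: "P \<subseteq> pverts T" "card P \<le> 2" "\<And>u v. adj T u v \<Longrightarrow> (u \<in> P) \<noteq> (v \<in> P)"
            unfolding almost_star_iff[OF assms(1)] by blast
          have "?free (t - 3) (2 * (t - 3))"
            using free_regular_bipartite[OF _ P] assms(2) t3 by simp
          moreover have "odd (t - 3)" using False t3 by simp
          moreover have "t - 3 + 2 \<le> t" using t3 by simp
          ultimately show ?thesis using free_regular_odd_degree[OF d1 _ ne _ \<open>even n\<close> sq(2)] by blast
        qed
      qed
    qed
  qed
  have C3: "regex n T = t - 4" "t \<ge> 4"
    if nC1: "\<not> (t - 1 dvd n)" "\<not> (star_graph T \<and> (even t \<or> even n))"
      and nC2: "even t" "\<not> t - 2 dvd n" "\<not> star_graph T" "\<not> (almost_star T \<and> even n)"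
  proof -
    have "t \<noteq> 2" "t \<noteq> 3" using nC1(1) nC2(1) by auto
    then show t4: "t \<ge> 4" using assms(3) by simp
    \<comment> \<open>Here \<open>d = t - 3\<close> is odd, so a host forces \<open>n\<close> to be
      even. The tree is then not an almost-star, and the divisibility of \<open>n\<close> by
      \<open>t - 2\<close> follows, a contradiction.\<close>
    have not_t3: "t \<noteq> d + 3" if "?free d n" for d
    proof
      assume d: "t = d + 3"
      then have "odd d" using nC2(1) by simp
      then have "even n" using free_regular_even[OF that] by simp
      then have "\<not> almost_star T" using nC2(4) by blast
      then have col: "\<exists>u v. adj T u v \<and> (u \<in> P \<longleftrightarrow> v \<in> P)" if "P \<subseteq> pverts T" "card P \<le> 2" for P
        using that unfolding almost_star_iff[OF assms(1)] by blast
      obtain a b c e where "simple_path (pverts T) (adj T) [a, b, c, e]"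
        using no_star_path[OF nC2(3)] by blast
      then have "d + 1 dvd n"
        using free_regular_dvd_odd[OF that _ _ \<open>odd d\<close> col] assms(2) d by blast
      then show False using nC2(2) d by simp
    qed
    have "d \<le> t - 4" if "?free d n" for d
      using le[OF that] not_t2[OF that nC1] not_t3[OF that] by linarith
    moreover have "?free (t - 4) n" using small_even[of "t - 4"] nC2(1) t4 by simp
    ultimately show "regex n T = t - 4" using regex_eqI[OF T] by blast
  qed
  show "let C1 = (t - 1 dvd n \<or> (star_graph T \<and> (even t \<or> even n)));
         C2 = (odd t \<or> t - 2 dvd n \<or> star_graph T \<or> (almost_star T \<and> even n))
     in (C1 \<longrightarrow> int (regex n T) = int t - 2) \<and>
        (\<not> C1 \<and> C2 \<longrightarrow> int (regex n T) = int t - 3) \<and>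
        (\<not> C1 \<and> \<not> C2 \<longrightarrow> int (regex n T) = int t - 4)"
    unfolding Let_def
  proof (intro conjI impI)
    assume "t - 1 dvd n \<or> (star_graph T \<and> (even t \<or> even n))"
    then show "int (regex n T) = int t - 2" using C1 assms(3) by simp
  next
    assume "\<not> (t - 1 dvd n \<or> (star_graph T \<and> (even t \<or> even n))) \<and>
      (odd t \<or> t - 2 dvd n \<or> star_graph T \<or> (almost_star T \<and> even n))"
    then have "regex n T = t - 3" "t \<ge> 3" using C2 by blast+
    then show "int (regex n T) = int t - 3" by simp
  next
    assume "\<not> (t - 1 dvd n \<or> (star_graph T \<and> (even t \<or> even n))) \<and>
      \<not> (odd t \<or> t - 2 dvd n \<or> star_graph T \<or> (almost_star T \<and> even n))"
    then have "regex n T = t - 4" "t \<ge> 4" using C3 by blast+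
    then show "int (regex n T) = int t - 4" by simp
  qed
qed

end
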